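(* If $N$ is a finitely generated graded left submodule of a finite rank free graded left $\mathbf{A}$-module $\mathbf{A}^t$, then the initial submodule $\mathrm{in}(N)$ is a finitely generated left $\mathbf{A}$-module.
   Context: Fix a prime $p$ and an integer $n\ge 1$. Let $R=\mathbb{F}_p[x_1,\ldots,x_n]$ and let $\mathbf{A}=R\{f\}/(x_i^pf \mid 1\le i\le n)$, i.e. the quotient of the free noncommutative $\mathbb{F}_p$-algebra on $x_1,\ldots,x_n,f$ by the two-sided ideal generated by $x_ix_j-x_jx_i$ and $x_i^pf$ for all $1\le i,j\le n$. It is graded with $\deg(x_i)=\deg(f)=1$. In the graded free module $\mathbf{A}^t=\bigoplus_{i=1}^t\mathbf{A}\varepsilon_i$ the basis elements $\varepsilon_i$ are homogeneous of arbitrary integer degrees. Monomials and term order. A monomial of $\mathbf{A}$ is a nonzero product of the form $m=x^{v_0}fx^{v_1}f\cdots x^{v_{e-1}}fx^{v_e}$ with $v_0,\ldots,v_e\in\mathbb{N}^n$; this expression is unique, the monomials form an $\mathbb{F}_p$-basis of $\mathbf{A}$, and $e$ is the $f$-order $\mathrm{ord}_f(m)$. For monomials $m_1=x^{v_0}f\cdots fx^{v_e}$ and $m_2=x^{u_0}f\cdots fx^{u_d}$, put $m_1<m_2$ iff one of the following holds: (1) $\deg(m_1)<\deg(m_2)$; (2) degrees are equal and $\mathrm{ord}_f(m_1)<\mathrm{ord}_f(m_2)$; (3) degrees and $f$-orders are equal and, for some $j$, $v_i=u_i$ for all $i<j$ and $v_j<u_j$ in the reverse lexicographic order on $\mathbb{N}^n$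 (where $v<u$ iff $v\ne u$ and, at the smallest index $k$ with $v_k\neq u_k$, one has $v_k>u_k$; so $x_1<x_2<\cdots<x_n<1$ as exponent vectors). Monomials of $\mathbf{A}^t$ are the elements $a\varepsilon_i$ with $a$ a monomial of $\mathbf{A}$, ordered by $a\varepsilon_i<b\varepsilon_j$ iff $a<b$, or $a=b$ and $i<j$. For $0\ne g\in\mathbf{A}^t$, the initial term $\mathrm{in}(g)$ is the term (coefficient times monomial) of $g$ whose monomial is largest. For a left submodule $N\subseteq\mathbf{A}^t$, $\mathrm{in}(N)$ is the left submodule of $\mathbf{A}^t$ generated by the initial terms of all nonzero elements of $N$. *)

theory Defs
  imports
    "Berlekamp_Zassenhaus.Finite_Field"
    "HOL-Library.Poly_Mapping"
    "HOL-Library.Function_Algebras"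
begin

text \<open>
  Conventions. The prime \<open>p\<close> is \<open>CARD('p)\<close> for a type \<open>'p :: prime_card\<close>, and the field with \<open>p\<close>
  elements is \<open>'p mod_ring\<close>. The index set \<open>{1, \<dots>, n}\<close> of the commuting variables is a type
  \<open>'n :: {finite, linorder}\<close> with \<open>CARD('n) = n\<close>; its linear order only enters through the
  reverse lexicographic order.
\<close>

section \<open>The free algebra\<close>

datatype 'n letter = LX 'n | LF

datatype 'a word = Word (letters: "'a list")

instantiation word :: (type) monoid_add
begin

definition zero_word :: "'a word" where
  "zero_word = Word []"

definition plus_word :: "'a word \<Rightarrow> 'a word \<Rightarrow> 'a word" where
  "plus_word u v = Word (letters u @ letters v)"

instance
  by standard (simp_all add: zero_word_def plus_word_def)

end

text \<open>
  The free noncommutative algebra is the monoid algebra of the free monoid; the monoid operation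
  is written additively, so that the convolution product of \<^type>\<open>poly_mapping\<close> applies.
\<close>

type_synonym ('p, 'n) free_alg = "'n letter word \<Rightarrow>\<^sub>0 'p mod_ring"

definition free_x :: "'n \<Rightarrow> ('p::prime_card, 'n) free_alg" where
  "free_x i = Poly_Mapping.single (Word [LX i]) 1"

definition free_f :: "('p::prime_card, 'n) free_alg" where
  "free_f = Poly_Mapping.single (Word [LF]) 1"


section \<open>The quotient algebra\<close>

definition two_sided_ideal :: "'a::ring_1 set \<Rightarrow> bool" where
  "two_sided_ideal I \<longleftrightarrow> 0 \<in> I \<and> (\<forall>a\<in>I. \<forall>b\<in>I. a + b \<in> I) \<and> (\<forall>a\<in>I. \<forall>r s. r * a * s \<in> I)"

definition alg_relations :: "('p::prime_card, 'n) free_alg set" where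
  "alg_relations =
     {free_x i * free_x j - free_x j * free_x i | i j. True} \<union>
     {free_x i ^ CARD('p) * free_f | i. True}"

definition alg_ideal :: "('p::prime_card, 'n) free_alg set" where
  "alg_ideal = two_sided_ideal hull alg_relations"

definition alg_rel :: "('p::prime_card, 'n) free_alg \<Rightarrow> ('p, 'n) free_alg \<Rightarrow> bool" where
  "alg_rel a b \<longleftrightarrow> a - b \<in> alg_ideal"

lemma two_sided_ideal_alg_ideal: "two_sided_ideal alg_ideal"
  unfolding alg_ideal_def by (rule hull_in) (auto simp: two_sided_ideal_def)

lemma alg_ideal_0: "0 \<in> alg_ideal"
  and alg_ideal_add: "a \<in> alg_ideal \<Longrightarrow> b \<in> alg_ideal \<Longrightarrow> a + b \<in> alg_ideal"
  and alg_ideal_mult: "a \<in> alg_ideal \<Longrightarrow> r * a * s \<in> alg_ideal"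
  using two_sided_ideal_alg_ideal by (auto simp: two_sided_ideal_def)

lemma alg_ideal_mult_left: "a \<in> alg_ideal \<Longrightarrow> r * a \<in> alg_ideal"
  using alg_ideal_mult[of a r 1] by simp

lemma alg_ideal_mult_right: "a \<in> alg_ideal \<Longrightarrow> a * s \<in> alg_ideal"
  using alg_ideal_mult[of a 1 s] by simp

lemma alg_ideal_uminus: "a \<in> alg_ideal \<Longrightarrow> - a \<in> alg_ideal"
  using alg_ideal_mult_left[of a "- 1"] by simp

lemma equivp_alg_rel:
  "equivp (alg_rel :: ('p::prime_card, 'n) free_alg \<Rightarrow> ('p, 'n) free_alg \<Rightarrow> bool)"
  (is "equivp ?R")
proof (rule equivpI)
  show "reflp ?R"
    by (simp add: reflp_def alg_rel_def alg_ideal_0)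
  show "symp ?R"
    unfolding symp_def alg_rel_def by (metis alg_ideal_uminus minus_diff_eq)
  show "transp ?R"
  proof (rule transpI)
    fix a b c :: "('p, 'n) free_alg"
    assume "alg_rel a b" "alg_rel b c"
    then have "(a - b) + (b - c) \<in> alg_ideal"
      unfolding alg_rel_def by (rule alg_ideal_add)
    then show "alg_rel a c"
      by (simp add: alg_rel_def)
  qed
qed

quotient_type (overloaded) ('p, 'n) alg = "('p::prime_card, 'n) free_alg" / alg_rel
  by (rule equivp_alg_rel)

text \<open>The constant coefficient vanishes on the ideal, so the quotient is not the zero ring.\<close>

lemma plus_word_eq_0_iff: "u + v = (0 :: 'a word) \<longleftrightarrow> u = 0 \<and> v = 0"
  by (cases u; cases v) (auto simp: plus_word_def zero_word_def)

lemma lookup_times_0: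
  fixes a b :: "'a word \<Rightarrow>\<^sub>0 'b::semiring_0"
  shows "Poly_Mapping.lookup (a * b) 0 = Poly_Mapping.lookup a 0 * Poly_Mapping.lookup b 0"
proof -
  have eq: "(Poly_Mapping.lookup b q when (0 :: 'a word) = l + q) =
      ((Poly_Mapping.lookup b q when q = 0) when l = 0)" for l q
    using plus_word_eq_0_iff[of l q] by (auto simp: when_def)
  have "(\<Sum>q. (Poly_Mapping.lookup b q when (0 :: 'a word) = l + q)) =
      (Poly_Mapping.lookup b 0 when l = 0)" for l
    unfolding eq by (cases "l = 0") simp_all
  then show ?thesis
    by (simp add: times_poly_mapping.rep_eq prod_fun_def mult_when)
qed

lemma lookup_free:
  "Poly_Mapping.lookup (free_x i) 0 = 0" "Poly_Mapping.lookup free_f 0 = 0"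
  by (simp_all add: free_x_def free_f_def lookup_single zero_word_def)

lemma lookup_alg_ideal_0:
  fixes a :: "('p::prime_card, 'n) free_alg"
  assumes "a \<in> alg_ideal"
  shows "Poly_Mapping.lookup a 0 = 0"
proof -
  have "two_sided_ideal {a :: ('p, 'n) free_alg. Poly_Mapping.lookup a 0 = 0}"
    by (simp add: two_sided_ideal_def lookup_add lookup_times_0)
  moreover have "alg_relations \<subseteq> {a :: ('p, 'n) free_alg. Poly_Mapping.lookup a 0 = 0}"
    by (auto simp: alg_relations_def lookup_minus lookup_times_0 lookup_free)
  ultimately show ?thesis
    using assms hull_minimal unfolding alg_ideal_def by blast
qed

instantiation alg :: (prime_card, type) ring_1
begin

lift_definition zero_alg :: "('a, 'b) alg" is 0 .

lift_definition one_alg :: "('a, 'b) alg" is 1 .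

lift_definition plus_alg :: "('a, 'b) alg \<Rightarrow> ('a, 'b) alg \<Rightarrow> ('a, 'b) alg" is "(+)"
  unfolding alg_rel_def by (metis alg_ideal_add add_diff_add)

lift_definition uminus_alg :: "('a, 'b) alg \<Rightarrow> ('a, 'b) alg" is uminus
  unfolding alg_rel_def by (metis alg_ideal_uminus minus_diff_minus)

lift_definition minus_alg :: "('a, 'b) alg \<Rightarrow> ('a, 'b) alg \<Rightarrow> ('a, 'b) alg" is "(-)"
proof -
  fix a b c d :: "('a, 'b) free_alg"
  assume "alg_rel a b" "alg_rel c d"
  then have "(a - b) + - (c - d) \<in> alg_ideal"
    unfolding alg_rel_def by (intro alg_ideal_add alg_ideal_uminus)
  then show "alg_rel (a - c) (b - d)"
    by (simp add: alg_rel_def algebra_simps)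
qed

lift_definition times_alg :: "('a, 'b) alg \<Rightarrow> ('a, 'b) alg \<Rightarrow> ('a, 'b) alg" is "(*)"
proof -
  fix a b c d :: "('a, 'b) free_alg"
  assume "alg_rel a b" "alg_rel c d"
  then have "(a - b) * c + b * (c - d) \<in> alg_ideal"
    unfolding alg_rel_def by (intro alg_ideal_add alg_ideal_mult_left alg_ideal_mult_right)
  then show "alg_rel (a * c) (b * d)"
    by (simp add: alg_rel_def algebra_simps)
qed

instance
proof
  have "\<not> alg_rel (0 :: ('a, 'b) free_alg) 1"
  proof
    assume "alg_rel (0 :: ('a, 'b) free_alg) 1"
    then have "(- 1 :: ('a, 'b) free_alg) \<in> alg_ideal"
      by (simp add: alg_rel_def)
    from lookup_alg_ideal_0[OF this] show False
      by simp
  qed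
  then show "(0 :: ('a, 'b) alg) \<noteq> 1"
    by transfer
qed (transfer, simp add: alg_rel_def alg_ideal_0 algebra_simps)+

end

lift_definition alg_x :: "'n \<Rightarrow> ('p::prime_card, 'n) alg" is free_x .

lift_definition alg_f :: "('p::prime_card, 'n) alg" is free_f .

definition alg_const :: "'p::prime_card mod_ring \<Rightarrow> ('p, 'n) alg" where
  "alg_const c = abs_alg (Poly_Mapping.single 0 c)"

definition alg_scale :: "'p::prime_card mod_ring \<Rightarrow> ('p, 'n) alg \<Rightarrow> ('p, 'n) alg" where
  "alg_scale c a = alg_const c * a"

lemma alg_const_add: "alg_const (c + d) = alg_const c + alg_const d"
  by (simp add: alg_const_def plus_alg.abs_eq single_add)

lemma alg_const_mult: "alg_const (c * d) = alg_const c * alg_const d"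
  by (simp add: alg_const_def times_alg.abs_eq mult_single)

lemma alg_const_1: "alg_const 1 = 1"
  by (simp add: alg_const_def one_alg.abs_eq)

global_interpretation alg: vector_space alg_scale
  by standard
    (simp_all add: alg_scale_def alg_const_add alg_const_mult alg_const_1 algebra_simps)

text \<open>
  \<open>alg_homogeneous d\<close> is the graded component of degree \<open>d\<close>; it is zero for \<open>d < 0\<close>.
\<close>

definition alg_homogeneous :: "int \<Rightarrow> ('p::prime_card, 'n) alg set" where
  "alg_homogeneous d =
     {abs_alg a | a. \<forall>w\<in>Poly_Mapping.keys a. int (length (letters w)) = d}"


section \<open>Monomials and the term order\<close>

definition x_power :: "('n::{finite,linorder} \<Rightarrow> nat) \<Rightarrow> ('p::prime_card, 'n) alg" where
  "x_power v = prod_list (map (\<lambda>i. alg_x i ^ v i) (sorted_list_of_set UNIV))"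

text \<open>
  The nonempty list \<open>[v\<^sub>0, \<dots>, v\<^sub>e]\<close> of exponent vectors encodes the product
  \<open>x^v\<^sub>0 f x^v\<^sub>1 f \<dots> f x^v\<^sub>e\<close>, so its \<open>f\<close>-order is \<open>e\<close>. The empty list encodes nothing.
\<close>

fun monomial_product :: "('n::{finite,linorder} \<Rightarrow> nat) list \<Rightarrow> ('p::prime_card, 'n) alg" where
  "monomial_product [] = 0"
| "monomial_product [v] = x_power v"
| "monomial_product (v # w # vs) = x_power v * alg_f * monomial_product (w # vs)"

definition alg_monomials :: "('p::prime_card, 'n::{finite,linorder}) alg set" where
  "alg_monomials = range monomial_product - {0}"

definition exps_ord_f :: "('n::finite \<Rightarrow> nat) list \<Rightarrow> nat" where
  "exps_ord_f vs = length vs - 1"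

definition exps_deg :: "('n::finite \<Rightarrow> nat) list \<Rightarrow> nat" where
  "exps_deg vs = (\<Sum>v\<leftarrow>vs. \<Sum>i\<in>UNIV. v i) + exps_ord_f vs"

definition revlex_less :: "('n::linorder \<Rightarrow> nat) \<Rightarrow> ('n \<Rightarrow> nat) \<Rightarrow> bool" where
  "revlex_less v u \<longleftrightarrow> (\<exists>k. v k > u k \<and> (\<forall>l<k. v l = u l))"

definition exps_less ::
  "('n::{finite,linorder} \<Rightarrow> nat) list \<Rightarrow> ('n \<Rightarrow> nat) list \<Rightarrow> bool" where
  "exps_less vs us \<longleftrightarrow>
     exps_deg vs < exps_deg us \<or>
     exps_deg vs = exps_deg us \<and> exps_ord_f vs < exps_ord_f us \<or>
     exps_deg vs = exps_deg us \<and> exps_ord_f vs = exps_ord_f us \<and>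
       (\<exists>j<length vs. (\<forall>i<j. vs ! i = us ! i) \<and> revlex_less (vs ! j) (us ! j))"

definition monomial_less ::
  "('p::prime_card, 'n::{finite,linorder}) alg \<Rightarrow> ('p, 'n) alg \<Rightarrow> bool" where
  "monomial_less a b \<longleftrightarrow>
     a \<in> alg_monomials \<and> b \<in> alg_monomials \<and>
     (\<exists>vs us. a = monomial_product vs \<and> b = monomial_product us \<and> exps_less vs us)"

text \<open>\<open>alg_coeff g a\<close> is the coefficient of the monomial \<open>a\<close> in the expansion of \<open>g\<close> in monomials.\<close>

definition alg_coeff ::
  "('p::prime_card, 'n::{finite,linorder}) alg \<Rightarrow> ('p, 'n) alg \<Rightarrow> 'p mod_ring" where
  "alg_coeff g = alg.representation alg_monomials g"


section \<open>Left submodules of free modules of finite rank\<close>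

text \<open>
  The free left module of rank \<open>t\<close> consists of the functions on \<open>nat\<close> vanishing outside
  \<open>{..<t}\<close>; the value at \<open>i\<close> is the coordinate at the \<open>i\<close>-th basis element (counted from \<open>0\<close>).
\<close>

definition free_module :: "nat \<Rightarrow> (nat \<Rightarrow> 'a::ring_1) set" where
  "free_module t = {u. \<forall>i\<ge>t. u i = 0}"

definition left_submodule :: "nat \<Rightarrow> (nat \<Rightarrow> 'a::ring_1) set \<Rightarrow> bool" where
  "left_submodule t N \<longleftrightarrow>
     N \<subseteq> free_module t \<and> 0 \<in> N \<and> (\<forall>u\<in>N. \<forall>v\<in>N. u + v \<in> N) \<and>
     (\<forall>a. \<forall>u\<in>N. (\<lambda>i. a * u i) \<in> N)"

definition finitely_generated :: "nat \<Rightarrow> (nat \<Rightarrow> 'a::ring_1) set \<Rightarrow> bool" where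
  "finitely_generated t N \<longleftrightarrow>
     (\<exists>G. finite G \<and> G \<subseteq> free_module t \<and> N = left_submodule t hull G)"

text \<open>Here \<open>\<delta> i\<close> is the degree of the \<open>i\<close>-th basis element.\<close>

definition module_homogeneous ::
  "nat \<Rightarrow> (nat \<Rightarrow> int) \<Rightarrow> int \<Rightarrow> (nat \<Rightarrow> ('p::prime_card, 'n) alg) set" where
  "module_homogeneous t \<delta> d = {u \<in> free_module t. \<forall>i<t. u i \<in> alg_homogeneous (d - \<delta> i)}"

definition graded_submodule ::
  "nat \<Rightarrow> (nat \<Rightarrow> int) \<Rightarrow> (nat \<Rightarrow> ('p::prime_card, 'n) alg) set \<Rightarrow> bool" where
  "graded_submodule t \<delta> N \<longleftrightarrow>
     left_submodule t N \<and>
     (\<forall>g\<in>N. \<exists>D h. finite D \<and> (\<forall>d\<in>D. h d \<in> N \<inter> module_homogeneous t \<delta> d) \<and> g = (\<Sum>d\<in>D. h d))"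


section \<open>Initial terms and initial submodules\<close>

text \<open>The pair \<open>(a, i)\<close> stands for the monomial \<open>a \<epsilon>\<^sub>i\<close> of the free module.\<close>

definition module_monomial_less ::
  "('p::prime_card, 'n::{finite,linorder}) alg \<times> nat \<Rightarrow> ('p, 'n) alg \<times> nat \<Rightarrow> bool" where
  "module_monomial_less = (\<lambda>(a, i) (b, j). monomial_less a b \<or> a = b \<and> i < j)"

definition module_support ::
  "nat \<Rightarrow> (nat \<Rightarrow> ('p::prime_card, 'n::{finite,linorder}) alg) \<Rightarrow> (('p, 'n) alg \<times> nat) set" where
  "module_support t g = {(a, i). i < t \<and> a \<in> alg_monomials \<and> alg_coeff (g i) a \<noteq> 0}"

definition initial_monomial ::
  "nat \<Rightarrow> (nat \<Rightarrow> ('p::prime_card, 'n::{finite,linorder}) alg) \<Rightarrow> ('p, 'n) alg \<times> nat" where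
  "initial_monomial t g =
     (THE m. m \<in> module_support t g \<and>
        (\<forall>m'\<in>module_support t g. m' \<noteq> m \<longrightarrow> module_monomial_less m' m))"

definition initial_term ::
  "nat \<Rightarrow> (nat \<Rightarrow> ('p::prime_card, 'n::{finite,linorder}) alg) \<Rightarrow> nat \<Rightarrow> ('p, 'n) alg" where
  "initial_term t g =
     (case initial_monomial t g of
        (a, i) \<Rightarrow> (\<lambda>j. if j = i then alg_scale (alg_coeff (g i) a) a else 0))"

definition initial_submodule ::
  "nat \<Rightarrow> (nat \<Rightarrow> ('p::prime_card, 'n::{finite,linorder}) alg) set
    \<Rightarrow> (nat \<Rightarrow> ('p, 'n) alg) set" where
  "initial_submodule t N = left_submodule t hull (initial_term t ` (N - {0}))"

end

theory Submission
  imports Defs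
begin

text \<open>
  Every monomial that involves \<open>f\<close> is uniquely \<open>x^w f b\<close> with all entries of \<open>w\<close> below \<open>p\<close>
  and a monomial \<open>b\<close>, its tail. Let \<open>N\<close> be generated by finitely many elements and let \<open>D\<close> bound the
  degrees of the tails occurring in the generators. Left multiplication by \<open>x\<^sub>k\<close> creates no new
  tails, and left multiplication by \<open>f\<close> maps \<open>N\<close> into \<open>T = \<Sum>\<^sub>w x^w f N\<close>. Hence every element of \<open>N\<close> is
  \<open>m + h\<close>, where the tails in \<open>m\<close> have degree at most \<open>D\<close> and \<open>h \<in> T\<close> (\<open>tails_decomposition\<close>).

  The term order compares degrees first and is compatible with passing from \<open>b\<close> to \<open>x^w f b\<close>.
  Therefore a leading monomial of \<open>m + h\<close> with tail of degree above \<open>D\<close> is \<open>x^w f\<close> times the leading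
  monomial of an element of \<open>N\<close> (\<open>is_lead_tail\<close>). By induction on the number of factors \<open>f\<close>, the
  initial submodule is generated by the leading monomials without \<open>f\<close>, for which finitely many
  suffice by Dickson's lemma, and the leading monomials with tail of degree at most \<open>D\<close>, of which
  there are finitely many because \<open>w\<close> is bounded by \<open>p\<close>.

  These arguments take place on coefficients, so they rest on the fact that the monomials form a
  basis of the algebra. Linear independence is obtained from the rewriting of words to normal form:
  the sum of the coefficients of all words with a given normal form is a linear functional on the
  free algebra that vanishes on the defining ideal (\<open>lin_ext_normal_form_ideal\<close>).
\<close>


section \<open>Normal forms of words\<close>

text \<open>
  Left multiplication by a letter, carried out on the lists of exponent vectors that encode
  monomials; \<open>q\<close> is the exponent with \<open>x\<^sub>i^q f = 0\<close>. As in \<^const>\<open>monomial_product\<close>, the empty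
  list stands for zero.
\<close>

primrec letter_act ::
  "nat \<Rightarrow> 'n letter \<Rightarrow> ('n \<Rightarrow> nat) list \<Rightarrow> ('n \<Rightarrow> nat) list" where
  "letter_act q (LX i) l = (case l of [] \<Rightarrow> []
     | v # us \<Rightarrow> if us = [] \<or> Suc (v i) < q then v(i := Suc (v i)) # us else [])"
| "letter_act q LF l = (if l = [] then [] else (\<lambda>_. 0) # l)"

text \<open>
  For \<open>q = p\<close>, the encoding of the monomial that a word in the generators represents, or \<open>[]\<close> if the
  word is zero in the algebra.
\<close>

definition normal_form :: "nat \<Rightarrow> 'n letter list \<Rightarrow> ('n \<Rightarrow> nat) list" where
  "normal_form q ls = foldr (letter_act q) ls [\<lambda>_. 0]"

lemma normal_form_Nil: "normal_form q [] = [\<lambda>_. 0]"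
  and normal_form_Cons: "normal_form q (l # ls) = letter_act q l (normal_form q ls)"
  by (simp_all add: normal_form_def)

lemma letter_act_Nil: "letter_act q l [] = []"
  by (cases l) simp_all

lemma foldr_letter_act_Nil: "foldr (letter_act q) ls [] = []"
  by (induction ls) (simp_all add: letter_act_Nil)

lemma letter_act_commute:
  "letter_act q (LX i) (letter_act q (LX j) l) = letter_act q (LX j) (letter_act q (LX i) l)"
  by (cases l; cases "i = j") (auto simp: fun_upd_twist)

lemma normal_form_commute:
  "normal_form q (us @ LX i # LX j # ws) = normal_form q (us @ LX j # LX i # ws)"
  by (simp only: normal_form_def foldr_append foldr.simps o_apply letter_act_commute)

lemma foldr_replicate_letter_act:
  "us \<noteq> [] \<Longrightarrow> v i < q \<Longrightarrow> foldr (letter_act q) (replicate k (LX i)) (v # us) =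
     (if v i + k < q then v(i := v i + k) # us else [])"
  by (induction k) (auto simp: letter_act_Nil simp del: foldr_replicate)

lemma normal_form_kill:
  assumes "q > 0"
  shows "normal_form q (us @ replicate q (LX i) @ LF # ws) = []"
proof -
  define l where "l = foldr (letter_act q) ws [\<lambda>_. 0]"
  have "foldr (letter_act q) (replicate q (LX i)) (letter_act q LF l) = []"
    using assms by (cases "l = []") (auto simp: foldr_letter_act_Nil foldr_replicate_letter_act
        simp del: foldr_replicate)
  then show ?thesis
    by (simp add: normal_form_def l_def foldr_letter_act_Nil del: letter_act.simps foldr_replicate)
qed

text \<open>For \<open>q = p\<close>, these are the lists of exponent vectors that encode nonzero monomials.\<close>

definition valid_exps :: "nat \<Rightarrow> ('n \<Rightarrow> nat) list \<Rightarrow> bool" where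
  "valid_exps q vs \<longleftrightarrow> vs \<noteq> [] \<and> (\<forall>v\<in>set (butlast vs). \<forall>i. v i < q)"

lemma valid_exps_Nil: "\<not> valid_exps q []"
  and valid_exps_Cons:
    "valid_exps q (v # us) \<longleftrightarrow> us = [] \<or> (\<forall>i. v i < q) \<and> valid_exps q us"
  by (auto simp: valid_exps_def)

lemma normal_form_surj:
  fixes vs :: "('n::finite \<Rightarrow> nat) list"
  assumes "valid_exps q vs"
  shows "\<exists>ls. normal_form q ls = vs"
  using assms
proof (induction vs)
  case Nil
  then show ?case by (simp add: valid_exps_Nil)
next
  case (Cons v us)
  from Cons.prems show ?case
  proof (induction "\<Sum>i\<in>UNIV. v i" arbitrary: v rule: less_induct)
    case less
    show ?case
    proof (cases "v = (\<lambda>_. 0)")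
      case True
      show ?thesis
      proof (cases "us = []")
        case True
        with \<open>v = _\<close> show ?thesis using normal_form_Nil by metis
      next
        case False
        with less.prems Cons.IH obtain ls where "normal_form q ls = us"
          by (auto simp: valid_exps_Cons)
        with False True have "normal_form q (LF # ls) = v # us"
          by (simp add: normal_form_Cons)
        then show ?thesis by blast
      qed
    next
      case False
      then obtain i where i: "v i > 0" by (auto simp: fun_eq_iff)
      define v' where "v' = v(i := v i - 1)"
      have "sum v' UNIV < sum v UNIV"
        by (rule sum_strict_mono_ex1) (use i in \<open>auto simp: v'_def\<close>)
      moreover have "valid_exps q (v' # us)"
        using less.prems by (auto simp: valid_exps_Cons v'_def less_imp_diff_less)
      ultimately obtain ls where "normal_form q ls = v' # us"
        using less.hyps by blast
      moreover have "v'(i := Suc (v' i)) = v" "us = [] \<or> Suc (v' i) < q"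
        using i less.prems by (auto simp: v'_def valid_exps_Cons)
      ultimately have "normal_form q (LX i # ls) = v # us"
        by (simp add: normal_form_Cons)
      then show ?thesis by blast
    qed
  qed
qed


section \<open>Coefficients\<close>

lemma poly_mapping_induct_sum [case_names single add]:
  assumes single: "\<And>w c. P (Poly_Mapping.single w c)"
    and add: "\<And>a b. P a \<Longrightarrow> P b \<Longrightarrow> P (a + b)"
  shows "P (a :: 'a \<Rightarrow>\<^sub>0 'b::comm_monoid_add)"
proof -
  have "P (\<Sum>w\<in>S. Poly_Mapping.single w (Poly_Mapping.lookup a w))" if "finite S" for S
    using that
  proof induction
    case empty
    show ?case using single[of undefined 0] by simp
  qed (simp add: single add)
  moreover have "a = (\<Sum>w\<in>Poly_Mapping.keys a. Poly_Mapping.single w (Poly_Mapping.lookup a w))"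
    by (rule poly_mapping_eqI)
      (auto simp: lookup_sum lookup_single when_def in_keys_iff sum.delta)
  ultimately show ?thesis by (metis finite_keys)
qed

text \<open>The linear extension of a function on words to the free algebra.\<close>

definition lin_ext :: "('a \<Rightarrow> 'b) \<Rightarrow> ('a \<Rightarrow>\<^sub>0 'b::comm_ring_1) \<Rightarrow> 'b" where
  "lin_ext \<phi> a = (\<Sum>w\<in>Poly_Mapping.keys a. Poly_Mapping.lookup a w * \<phi> w)"

lemma lin_ext_superset:
  "finite S \<Longrightarrow> Poly_Mapping.keys a \<subseteq> S \<Longrightarrow>
    lin_ext \<phi> a = (\<Sum>w\<in>S. Poly_Mapping.lookup a w * \<phi> w)"
  unfolding lin_ext_def by (rule sum.mono_neutral_left) (auto simp: in_keys_iff)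

lemma lin_ext_add: "lin_ext \<phi> (a + b) = lin_ext \<phi> a + lin_ext \<phi> b"
proof -
  let ?S = "Poly_Mapping.keys a \<union> Poly_Mapping.keys b"
  have "Poly_Mapping.keys (a + b) \<subseteq> ?S" by (rule keys_add)
  then show ?thesis
    by (simp add: lin_ext_superset[of ?S] lookup_add distrib_right sum.distrib)
qed

lemma lin_ext_single: "lin_ext \<phi> (Poly_Mapping.single w c) = c * \<phi> w"
  by (subst lin_ext_superset[of "{w}"]) auto

lemma lin_ext_0: "lin_ext \<phi> 0 = 0"
  by (simp add: lin_ext_def)

lemma lin_ext_uminus: "lin_ext \<phi> (- a) = - lin_ext \<phi> a"
  using lin_ext_add[of \<phi> a "- a"] by (simp add: lin_ext_0 eq_neg_iff_add_eq_0 add.commute)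

lemma lin_ext_diff: "lin_ext \<phi> (a - b) = lin_ext \<phi> a - lin_ext \<phi> b"
  using lin_ext_add[of \<phi> a "- b"] by (simp add: lin_ext_uminus)

lemma lin_ext_single_times:
  fixes a :: "'a::monoid_add \<Rightarrow>\<^sub>0 'b::comm_ring_1"
  shows "lin_ext \<phi> (Poly_Mapping.single u c * a) = c * lin_ext (\<lambda>w. \<phi> (u + w)) a"
  by (induction a rule: poly_mapping_induct_sum)
    (simp_all add: mult_single lin_ext_single lin_ext_add distrib_left mult.assoc)

text \<open>
  The indicator function of the words with normal form \<open>vs\<close>. It vanishes for \<open>vs = []\<close>, because that
  list stands for zero and not for a monomial.
\<close>

definition normal_form_indicator ::
  "nat \<Rightarrow> ('n \<Rightarrow> nat) list \<Rightarrow> 'n letter word \<Rightarrow> 'b::comm_ring_1" where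
  "normal_form_indicator q vs w =
     (if vs \<noteq> [] \<and> normal_form q (letters w) = vs then 1 else 0)"

lemma free_x_power:
  "free_x i ^ k = (Poly_Mapping.single (Word (replicate k (LX i))) 1 :: ('p::prime_card, 'n) free_alg)"
proof (induction k)
  case 0
  show ?case by (simp add: zero_word_def[symmetric])
qed (simp add: free_x_def mult_single plus_word_def)

text \<open>
  Summing the coefficients of all words with a given normal form is well defined on the quotient.
  The kernel of a functional need not be a two-sided ideal, hence the detour through the elements that
  are annihilated after every multiplication from both sides.
\<close>

lemma lin_ext_normal_form_ideal:
  fixes a :: "('p::prime_card, 'n) free_alg"
  assumes "a \<in> alg_ideal"
  shows "lin_ext (normal_form_indicator CARD('p) vs) a = 0"
proof -
  let ?\<phi> = "normal_form_indicator CARD('p) vs :: 'n letter word \<Rightarrow> 'p mod_ring"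
  let ?K = "{a :: ('p, 'n) free_alg. \<forall>r s. lin_ext ?\<phi> (r * a * s) = 0}"
  have "two_sided_ideal ?K"
  proof -
    have "r * (r' * a * s') * s = (r * r') * a * (s' * s)" for r r' a s s' :: "('p, 'n) free_alg"
      by (simp add: mult.assoc)
    then show ?thesis
      by (simp add: two_sided_ideal_def lin_ext_0 distrib_left distrib_right lin_ext_add)
  qed
  moreover have "alg_relations \<subseteq> ?K"
  proof
    fix \<rho> :: "('p, 'n) free_alg"
    assume "\<rho> \<in> alg_relations"
    then consider i j where "\<rho> = free_x i * free_x j - free_x j * free_x i"
      | i where "\<rho> = free_x i ^ CARD('p) * free_f"
      by (auto simp: alg_relations_def)
    then have single: "lin_ext ?\<phi> (Poly_Mapping.single u c * \<rho> * Poly_Mapping.single s d) = 0"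
      for u s c d
    proof cases
      case 1
      have "?\<phi> (u + Word [LX i, LX j] + s) = ?\<phi> (u + Word [LX j, LX i] + s)"
        using normal_form_commute[of "CARD('p)" "letters u" i j "letters s"]
        by (simp add: normal_form_indicator_def plus_word_def)
      then show ?thesis
        by (simp add: 1 free_x_def mult_single plus_word_def left_diff_distrib right_diff_distrib
            lin_ext_diff lin_ext_single)
    next
      case 2
      have "?\<phi> (u + Word (replicate CARD('p) (LX i) @ [LF]) + s) = 0"
        using normal_form_kill[of "CARD('p)" "letters u" i "letters s"]
        by (auto simp: normal_form_indicator_def plus_word_def)
      then show ?thesis
        by (auto simp: 2 free_x_power free_f_def mult_single plus_word_def lin_ext_single)
    qed
    have "lin_ext ?\<phi> (Poly_Mapping.single u c * \<rho> * s) = 0" for u c s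
      by (induction s rule: poly_mapping_induct_sum)
        (simp_all add: single distrib_left lin_ext_add)
    then have "lin_ext ?\<phi> (r * \<rho> * s) = 0" for r s
      by (induction r rule: poly_mapping_induct_sum)
        (simp_all add: distrib_right lin_ext_add)
    then show "\<rho> \<in> ?K" by simp
  qed
  ultimately have "a \<in> ?K"
    using assms hull_minimal unfolding alg_ideal_def by blast
  then have "lin_ext ?\<phi> (1 * a * 1) = 0" by blast
  then show ?thesis by simp
qed

text \<open>
  The coefficient of the monomial encoded by \<open>vs\<close>, computed from normal forms of words. It is zero
  unless \<open>vs\<close> is valid, and on valid lists it agrees with \<^const>\<open>alg_coeff\<close>.
\<close>

definition mon_coeff :: "('p::prime_card, 'n) alg \<Rightarrow> ('n \<Rightarrow> nat) list \<Rightarrow> 'p mod_ring" where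
  "mon_coeff a vs = lin_ext (normal_form_indicator CARD('p) vs) (rep_alg a)"

lemma mon_coeff_abs:
  fixes r :: "('p::prime_card, 'n) free_alg"
  shows "mon_coeff (abs_alg r) vs = lin_ext (normal_form_indicator CARD('p) vs) r"
proof -
  have "alg_rel r (rep_alg (abs_alg r))"
    by (metis Quotient_alg Quotient_abs_rep alg.abs_eq_iff)
  then have "r - rep_alg (abs_alg r) \<in> alg_ideal" by (simp add: alg_rel_def)
  from lin_ext_normal_form_ideal[OF this] show ?thesis
    by (simp add: mon_coeff_def lin_ext_diff)
qed

lemma mon_coeff_add: "mon_coeff (a + b) vs = mon_coeff a vs + mon_coeff b vs"
  by (induction a rule: alg.abs_induct; induction b rule: alg.abs_induct)
    (simp add: mon_coeff_abs plus_alg.abs_eq lin_ext_add)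

lemma mon_coeff_0: "mon_coeff 0 vs = 0"
  by (simp add: zero_alg.abs_eq mon_coeff_abs lin_ext_0)

lemma mon_coeff_scale: "mon_coeff (alg_const c * a) vs = c * mon_coeff a vs"
  by (induction a rule: alg.abs_induct)
    (simp add: alg_const_def mon_coeff_abs times_alg.abs_eq lin_ext_single_times)

lemma mon_coeff_sum: "mon_coeff (sum h A) vs = (\<Sum>x\<in>A. mon_coeff (h x) vs)"
  by (induction A rule: infinite_finite_induct) (simp_all add: mon_coeff_0 mon_coeff_add)

lemma mon_coeff_Nil: "mon_coeff a [] = 0"
  by (simp add: mon_coeff_def normal_form_indicator_def lin_ext_def)

lemma mon_coeff_x:
  fixes a :: "('p::prime_card, 'n) alg"
  shows "mon_coeff (alg_x i * a) (v # us) =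
    (if v i > 0 \<and> (us = [] \<or> v i < CARD('p)) then mon_coeff a (v(i := v i - 1) # us) else 0)"
proof -
  have iff: "letter_act CARD('p) (LX i) l = v # us \<longleftrightarrow>
      (v i > 0 \<and> (us = [] \<or> v i < CARD('p))) \<and> l = v(i := v i - 1) # us" for l
    by (cases l) (auto simp: fun_eq_iff)
  have "normal_form_indicator CARD('p) (v # us) (Word [LX i] + w) =
      (if v i > 0 \<and> (us = [] \<or> v i < CARD('p))
       then normal_form_indicator CARD('p) (v(i := v i - 1) # us) w else (0 :: 'p mod_ring))" for w
    by (simp add: normal_form_indicator_def plus_word_def normal_form_Cons iff
        del: letter_act.simps)
  then show ?thesis
    by (induction a rule: alg.abs_induct)
      (simp add: alg_x.abs_eq free_x_def mon_coeff_abs times_alg.abs_eq lin_ext_single_times,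
        simp add: lin_ext_def)
qed

lemma mon_coeff_f:
  fixes a :: "('p::prime_card, 'n) alg"
  shows "mon_coeff (alg_f * a) (v # us) = (if v = (\<lambda>_. 0) then mon_coeff a us else 0)"
proof -
  have "normal_form_indicator CARD('p) (v # us) (Word [LF] + w) =
      (if v = (\<lambda>_. 0) then normal_form_indicator CARD('p) us w else (0 :: 'p mod_ring))" for w
    by (auto simp: normal_form_indicator_def plus_word_def normal_form_Cons)
  then show ?thesis
    by (induction a rule: alg.abs_induct)
      (simp add: alg_f.abs_eq free_f_def mon_coeff_abs times_alg.abs_eq lin_ext_single_times,
        simp add: lin_ext_def)
qed


section \<open>The monomial basis\<close>

lemma alg_x_commute: "alg_x i * alg_x j = (alg_x j * alg_x i :: ('p::prime_card, 'n) alg)"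
proof -
  have "free_x i * free_x j - free_x j * free_x i \<in> (alg_relations :: ('p, 'n) free_alg set)"
    unfolding alg_relations_def by blast
  then have "alg_rel (free_x i * free_x j) (free_x j * free_x i :: ('p, 'n) free_alg)"
    unfolding alg_rel_def alg_ideal_def by (rule hull_inc)
  then show ?thesis by transfer
qed

lemma alg_x_power_abs: "alg_x i ^ k = abs_alg (free_x i ^ k)"
  by (induction k) (simp_all add: one_alg.abs_eq alg_x.abs_eq times_alg.abs_eq)

lemma alg_x_power_f: "alg_x i ^ CARD('p) * alg_f = (0 :: ('p::prime_card, 'n) alg)"
proof -
  have "free_x i ^ CARD('p) * free_f \<in> (alg_relations :: ('p, 'n) free_alg set)"
    unfolding alg_relations_def by blast
  then have "alg_rel (free_x i ^ CARD('p) * free_f) (0 :: ('p, 'n) free_alg)"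
    unfolding alg_rel_def alg_ideal_def by (simp add: hull_inc)
  then show ?thesis
    by (simp add: alg_x_power_abs alg_f.abs_eq times_alg.abs_eq zero_alg.abs_eq alg.abs_eq_iff)
qed

lemma alg_x_powers_commute: "alg_x i ^ a * alg_x j ^ b = alg_x j ^ b * alg_x i ^ a"
  by (metis alg_x_commute power_commuting_commutes)

lemma alg_x_power_prod_list_commute:
  "alg_x i ^ a * prod_list (map (\<lambda>i. alg_x i ^ v i) js) =
     prod_list (map (\<lambda>i. alg_x i ^ v i) js) * alg_x i ^ a"
  by (induction js) (simp_all add: mult.assoc[symmetric] alg_x_powers_commute[of i a],
      simp add: mult.assoc)

lemma x_power_add:
  "x_power v * x_power w =
    (x_power (\<lambda>i. v i + w i) :: ('p::prime_card, 'n::{finite,linorder}) alg)"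
proof -
  have "prod_list (map (\<lambda>i. alg_x i ^ v i) js) * prod_list (map (\<lambda>i. alg_x i ^ w i) js) =
      (prod_list (map (\<lambda>i. alg_x i ^ (v i + w i)) js) :: ('p, 'n) alg)" for js
  proof (induction js)
    case (Cons j js)
    have "alg_x j ^ v j * prod_list (map (\<lambda>i. alg_x i ^ v i) js) *
        (alg_x j ^ w j * prod_list (map (\<lambda>i. alg_x i ^ w i) js)) =
      alg_x j ^ v j * (prod_list (map (\<lambda>i. alg_x i ^ v i) js) * alg_x j ^ w j) *
        (prod_list (map (\<lambda>i. alg_x i ^ w i) js) :: ('p, 'n) alg)"
      by (simp add: mult.assoc)
    also have "\<dots> = alg_x j ^ v j * alg_x j ^ w j * (prod_list (map (\<lambda>i. alg_x i ^ v i) js) *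
        prod_list (map (\<lambda>i. alg_x i ^ w i) js))"
      unfolding alg_x_power_prod_list_commute[symmetric] by (simp add: mult.assoc)
    finally show ?case
      by (simp add: Cons.IH power_add[of "alg_x j" "v j" "w j"])
  qed simp
  then show ?thesis by (simp add: x_power_def)
qed

lemma x_power_0: "x_power (\<lambda>_. 0) = 1"
  unfolding x_power_def by (simp add: map_replicate_const)

lemma x_power_single:
  "x_power ((\<lambda>_. 0)(i := k)) = (alg_x i ^ k :: ('p::prime_card, 'n::{finite,linorder}) alg)"
proof -
  have "prod_list (map (\<lambda>j. alg_x j ^ ((\<lambda>_. 0)(i := k)) j) js) =
      (if i \<in> set js then alg_x i ^ k else (1 :: ('p, 'n) alg))" if "distinct js" for js
    using that by (induction js) auto
  then show ?thesis by (simp add: x_power_def)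
qed

lemma alg_x_times_x_power: "alg_x i * x_power v = x_power (v(i := Suc (v i)))"
proof -
  have "alg_x i * x_power v = x_power ((\<lambda>_. 0)(i := 1)) * x_power v"
    by (simp add: x_power_single)
  also have "\<dots> = x_power (v(i := Suc (v i)))"
    unfolding x_power_add by (rule arg_cong[where f = x_power]) auto
  finally show ?thesis .
qed

lemma x_power_times_f:
  assumes "v i \<ge> CARD('p)"
  shows "x_power v * alg_f = (0 :: ('p::prime_card, 'n::{finite,linorder}) alg)"
proof -
  have "x_power v = (x_power (v(i := v i - CARD('p))) * x_power ((\<lambda>_. 0)(i := CARD('p)))
      :: ('p, 'n) alg)"
    unfolding x_power_add using assms by (intro arg_cong[where f = x_power]) auto
  then have "x_power v * alg_f =
      (x_power (v(i := v i - CARD('p))) * (alg_x i ^ CARD('p) * alg_f) :: ('p, 'n) alg)"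
    by (simp only: x_power_single mult.assoc)
  then show ?thesis
    by (simp only: alg_x_power_f mult_zero_right)
qed

lemma monomial_product_Cons:
  "us \<noteq> [] \<Longrightarrow> monomial_product (v # us) = x_power v * (alg_f * monomial_product us)"
  by (cases us) (simp_all add: mult.assoc)

lemma alg_x_times_monomial_product:
  fixes i :: "'n::{finite,linorder}"
  shows "alg_x i * monomial_product l =
    (monomial_product (letter_act CARD('p) (LX i) l) :: ('p::prime_card, 'n) alg)"
proof (cases l)
  case (Cons v us)
  have "monomial_product (v(i := Suc (v i)) # us) = (0 :: ('p, 'n) alg)"
    if "us \<noteq> []" "\<not> Suc (v i) < CARD('p)"
  proof -
    have "x_power (v(i := Suc (v i))) * alg_f = (0 :: ('p, 'n) alg)"
      by (rule x_power_times_f[of _ i]) (use that in auto)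
    then show ?thesis
      using that(1) by (simp add: monomial_product_Cons mult.assoc[symmetric])
  qed
  moreover have "alg_x i * monomial_product (v # us) =
      (monomial_product (v(i := Suc (v i)) # us) :: ('p, 'n) alg)"
    by (cases "us = []")
      (simp_all add: alg_x_times_x_power monomial_product_Cons mult.assoc[symmetric])
  ultimately show ?thesis
    using Cons by auto
qed simp

lemma alg_f_times_monomial_product:
  "alg_f * monomial_product l =
    (monomial_product (letter_act CARD('p) LF l) :: ('p::prime_card, 'n::{finite,linorder}) alg)"
  by (simp add: monomial_product_Cons x_power_0)

lemma abs_alg_Cons:
  "abs_alg (Poly_Mapping.single (Word (l # ls)) c) =
    (case l of LX i \<Rightarrow> alg_x i | LF \<Rightarrow> alg_f) * abs_alg (Poly_Mapping.single (Word ls) c)"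
  by (cases l)
    (simp_all add: alg_x.abs_eq alg_f.abs_eq times_alg.abs_eq free_x_def free_f_def mult_single
      plus_word_def)

lemma abs_alg_word:
  "abs_alg (Poly_Mapping.single (Word ls) 1) =
    (monomial_product (normal_form CARD('p) ls) :: ('p::prime_card, 'n::{finite,linorder}) alg)"
proof (induction ls)
  case Nil
  show ?case
    by (simp add: normal_form_Nil x_power_0 one_alg.abs_eq zero_word_def[symmetric])
next
  case (Cons l ls)
  then show ?case
    by (cases l)
      (simp_all add: abs_alg_Cons normal_form_Cons alg_x_times_monomial_product
        alg_f_times_monomial_product del: letter_act.simps)
qed

lemma abs_alg_single:
  "abs_alg (Poly_Mapping.single w c) =
    (alg_scale c (monomial_product (normal_form CARD('p) (letters w)))
      :: ('p::prime_card, 'n::{finite,linorder}) alg)"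
proof -
  have "abs_alg (Poly_Mapping.single w c) =
      (alg_scale c (abs_alg (Poly_Mapping.single w 1)) :: ('p, 'n) alg)"
    by (simp add: alg_scale_def alg_const_def times_alg.abs_eq mult_single)
  then show ?thesis
    by (simp add: abs_alg_word[symmetric])
qed

lemma alg_induct [case_names const x f add]:
  fixes a :: "('p::prime_card, 'n) alg"
  assumes const: "\<And>c. P (alg_const c)"
    and x: "\<And>i a. P a \<Longrightarrow> P (alg_x i * a)"
    and f: "\<And>a. P a \<Longrightarrow> P (alg_f * a)"
    and add: "\<And>a b. P a \<Longrightarrow> P b \<Longrightarrow> P (a + b)"
  shows "P a"
proof -
  have word: "P (abs_alg (Poly_Mapping.single (Word ls) c))" for ls c
  proof (induction ls)
    case Nil
    show ?case using const[of c] by (simp add: alg_const_def zero_word_def)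
  next
    case (Cons l ls)
    then show ?case using x f by (cases l) (auto simp: abs_alg_Cons)
  qed
  have "P (abs_alg r)" for r
  proof (induction r rule: poly_mapping_induct_sum)
    case (single w c)
    show ?case using word[of "letters w" c] by simp
  next
    case (add r s)
    then show ?case using assms(4) by (simp add: plus_alg.abs_eq[symmetric])
  qed
  then show ?thesis by (induction a rule: alg.abs_induct)
qed

lemma monomial_product_invalid:
  "\<not> valid_exps CARD('p) vs \<Longrightarrow>
    monomial_product vs = (0 :: ('p::prime_card, 'n::{finite,linorder}) alg)"
proof (induction vs)
  case (Cons v us)
  then have "us \<noteq> []" and "(\<exists>i. v i \<ge> CARD('p)) \<or> \<not> valid_exps CARD('p) us"
    by (auto simp: valid_exps_Cons not_less)
  then show ?case
    using Cons.IH
    by (auto simp: monomial_product_Cons mult.assoc[symmetric] x_power_times_f)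
qed simp

lemma mon_coeff_monomial_product:
  assumes "valid_exps CARD('p) vs"
  shows "mon_coeff (monomial_product vs :: ('p::prime_card, 'n::{finite,linorder}) alg) us =
    (if us = vs then 1 else 0)"
proof -
  obtain ls where ls: "normal_form CARD('p) ls = vs"
    using normal_form_surj[OF assms] by blast
  have "vs \<noteq> []" using assms by (auto simp: valid_exps_Nil)
  moreover have "monomial_product vs = (abs_alg (Poly_Mapping.single (Word ls) 1) :: ('p, 'n) alg)"
    by (simp add: abs_alg_word ls)
  ultimately show ?thesis
    by (auto simp: mon_coeff_abs lin_ext_single normal_form_indicator_def ls)
qed

lemma monomial_product_eq_0_iff:
  "monomial_product vs = (0 :: ('p::prime_card, 'n::{finite,linorder}) alg) \<longleftrightarrow>
    \<not> valid_exps CARD('p) vs"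
proof
  assume zero: "monomial_product vs = (0 :: ('p, 'n) alg)"
  show "\<not> valid_exps CARD('p) vs"
  proof
    assume "valid_exps CARD('p) vs"
    from mon_coeff_monomial_product[OF this, of vs] show False
      by (simp add: zero mon_coeff_0)
  qed
qed (rule monomial_product_invalid)

lemma alg_monomials_eq:
  "(alg_monomials :: ('p::prime_card, 'n::{finite,linorder}) alg set) =
    monomial_product ` {vs. valid_exps CARD('p) vs}"
  by (auto simp: alg_monomials_def monomial_product_eq_0_iff)

lemma inj_on_monomial_product:
  "inj_on (monomial_product :: _ \<Rightarrow> ('p::prime_card, 'n::{finite,linorder}) alg)
    {vs. valid_exps CARD('p) vs}"
proof (rule inj_onI, clarsimp)
  fix vs us :: "('n \<Rightarrow> nat) list"
  assume *: "valid_exps CARD('p) vs" "valid_exps CARD('p) us"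
    "monomial_product vs = (monomial_product us :: ('p, 'n) alg)"
  then have "mon_coeff (monomial_product us :: ('p, 'n) alg) vs = 1"
    by (metis mon_coeff_monomial_product)
  with * show "vs = us"
    by (metis mon_coeff_monomial_product zero_neq_one)
qed

lemma independent_alg_monomials:
  "\<not> alg.dependent (alg_monomials :: ('p::prime_card, 'n::{finite,linorder}) alg set)"
proof
  assume "alg.dependent (alg_monomials :: ('p, 'n) alg set)"
  then obtain T c b where T: "finite T" "T \<subseteq> alg_monomials" "b \<in> T"
    and sum: "(\<Sum>a\<in>T. alg_scale (c a) a) = (0 :: ('p, 'n) alg)" and c: "c b \<noteq> 0"
    unfolding alg.dependent_explicit by blast
  obtain vs where vs: "valid_exps CARD('p) vs" "b = monomial_product vs"
    using T by (auto simp: alg_monomials_eq)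
  have "mon_coeff (alg_scale (c a) a) vs = (if a = b then c a else 0)" if "a \<in> T" for a
  proof -
    obtain us where "valid_exps CARD('p) us" "a = monomial_product us"
      using \<open>a \<in> T\<close> T(2) by (auto simp: alg_monomials_eq)
    then show ?thesis
      using vs by (auto simp: mon_coeff_monomial_product alg_scale_def mon_coeff_scale
          dest: inj_onD[OF inj_on_monomial_product])
  qed
  then have "mon_coeff (\<Sum>a\<in>T. alg_scale (c a) a) vs = (\<Sum>a\<in>T. if a = b then c a else 0)"
    by (simp add: mon_coeff_sum)
  also have "\<dots> = c b"
    using T by simp
  finally show False
    using c by (simp add: sum mon_coeff_0)
qed

lemma span_alg_monomials:
  "alg.span (alg_monomials :: ('p::prime_card, 'n::{finite,linorder}) alg set) = UNIV"
proof -
  have "abs_alg r \<in> alg.span (alg_monomials :: ('p, 'n) alg set)" for r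
  proof (induction r rule: poly_mapping_induct_sum)
    case (single w c)
    have "monomial_product vs \<in> alg.span (alg_monomials :: ('p, 'n) alg set)" for vs
      by (cases "monomial_product vs = (0 :: ('p, 'n) alg)")
        (auto simp: alg_monomials_def intro: alg.span_base alg.span_zero)
    then show ?case
      by (simp add: abs_alg_single alg.span_scale)
  next
    case (add r s)
    then show ?case by (simp add: plus_alg.abs_eq[symmetric] alg.span_add)
  qed
  then have "a \<in> alg.span (alg_monomials :: ('p, 'n) alg set)" for a
    by (induction a rule: alg.abs_induct)
  then show ?thesis by blast
qed

lemma alg_coeff_sum:
  "(\<Sum>b | alg_coeff a b \<noteq> 0. alg_scale (alg_coeff a b) b) =
    (a :: ('p::prime_card, 'n::{finite,linorder}) alg)"
  unfolding alg_coeff_def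
  by (rule alg.sum_nonzero_representation_eq)
    (simp_all add: independent_alg_monomials span_alg_monomials)

lemma finite_alg_coeff: "finite {b. alg_coeff a b \<noteq> 0}"
  and alg_coeff_nonzero: "alg_coeff a b \<noteq> 0 \<Longrightarrow> b \<in> alg_monomials"
  by (auto simp: alg_coeff_def alg.finite_representation intro: alg.representation_ne_zero)

lemma alg_coeff_monomial_product:
  fixes a :: "('p::prime_card, 'n::{finite,linorder}) alg"
  assumes "valid_exps CARD('p) vs"
  shows "alg_coeff a (monomial_product vs) = mon_coeff a vs"
proof -
  let ?S = "{b. alg_coeff a b \<noteq> 0}"
  have "mon_coeff (alg_scale (alg_coeff a b) b) vs =
      (if b = monomial_product vs then alg_coeff a b else 0)" if "b \<in> ?S" for b
    using alg_coeff_nonzero[of a b] that assms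
    by (auto simp: alg_monomials_eq mon_coeff_monomial_product alg_scale_def mon_coeff_scale)
  then have "mon_coeff (\<Sum>b\<in>?S. alg_scale (alg_coeff a b) b) vs =
      (\<Sum>b\<in>?S. if b = monomial_product vs then alg_coeff a b else 0)"
    by (simp add: mon_coeff_sum)
  also have "\<dots> = alg_coeff a (monomial_product vs)"
    using finite_alg_coeff[of a] by simp
  finally show ?thesis by (simp add: alg_coeff_sum)
qed

lemma mon_coeff_valid:
  fixes a :: "('p::prime_card, 'n::{finite,linorder}) alg"
  assumes "mon_coeff a vs \<noteq> 0"
  shows "valid_exps CARD('p) vs"
proof (rule ccontr)
  assume "\<not> ?thesis"
  then have "mon_coeff b vs = 0" if "b \<in> alg_monomials" for b :: "('p, 'n) alg"
    using that by (auto simp: alg_monomials_eq mon_coeff_monomial_product)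
  then have "mon_coeff (\<Sum>b | alg_coeff a b \<noteq> 0. alg_scale (alg_coeff a b) b) vs = 0"
    by (auto simp: mon_coeff_sum alg_scale_def mon_coeff_scale alg_coeff_nonzero
        intro!: sum.neutral)
  with assms show False by (simp add: alg_coeff_sum)
qed

lemma finite_mon_coeff:
  fixes a :: "('p::prime_card, 'n::{finite,linorder}) alg"
  shows "finite {vs. mon_coeff a vs \<noteq> 0}"
proof (rule finite_imageD)
  have "monomial_product ` {vs. mon_coeff a vs \<noteq> 0} \<subseteq> {b. alg_coeff a b \<noteq> 0}"
    by (auto simp: alg_coeff_monomial_product mon_coeff_valid)
  then show "finite ((monomial_product :: _ \<Rightarrow> ('p, 'n) alg) ` {vs. mon_coeff a vs \<noteq> 0})"
    using finite_alg_coeff finite_subset by blast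
  show "inj_on (monomial_product :: _ \<Rightarrow> ('p, 'n) alg) {vs. mon_coeff a vs \<noteq> 0}"
    by (rule inj_on_subset[OF inj_on_monomial_product]) (auto dest: mon_coeff_valid)
qed

lemma mon_coeff_nonzero_ex:
  fixes a :: "('p::prime_card, 'n::{finite,linorder}) alg"
  assumes "a \<noteq> 0"
  obtains vs where "mon_coeff a vs \<noteq> 0"
proof -
  have "{b. alg_coeff a b \<noteq> 0} \<noteq> {}"
    using assms alg_coeff_sum[of a] by (metis sum.empty)
  then show thesis
    using that alg_coeff_nonzero by (fastforce simp: alg_monomials_eq alg_coeff_monomial_product)
qed


section \<open>Dickson's lemma\<close>

lemma nat_seq_incseq_subseq:
  fixes s :: "nat \<Rightarrow> nat"
  shows "\<exists>r :: nat \<Rightarrow> nat. strict_mono r \<and> mono (\<lambda>m. s (r m))"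
proof -
  obtain r where r: "strict_mono r" "monoseq (\<lambda>m. s (r m))"
    using seq_monosub by blast
  show ?thesis
  proof (cases "incseq (\<lambda>m. s (r m))")
    case False
    \<comment> \<open>A decreasing sequence of natural numbers is constant from the place where it is minimal.\<close>
    then have dec: "decseq (\<lambda>m. s (r m))"
      using r(2) by (simp add: monoseq_iff)
    define c where "c = (LEAST x. x \<in> range (\<lambda>m. s (r m)))"
    have "c \<in> range (\<lambda>m. s (r m))"
      unfolding c_def by (rule LeastI[of _ "s (r 0)"]) blast
    then obtain k where k: "s (r k) = c" by auto
    have "s (r (m + k)) = c" for m
    proof (rule antisym)
      show "s (r (m + k)) \<le> c" using decseqD[OF dec, of k "m + k"] k by simp
      show "c \<le> s (r (m + k))" unfolding c_def by (rule Least_le) blast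
    qed
    moreover have "strict_mono (\<lambda>m. r (m + k))"
      using r(1) by (simp add: strict_mono_def)
    ultimately show ?thesis by (intro exI[of _ "\<lambda>m. r (m + k)"]) (simp add: mono_def)
  qed (use r in blast)
qed

lemma nat_vector_seq_incseq_subseq:
  fixes s :: "nat \<Rightarrow> 'n \<Rightarrow> nat"
  assumes "finite K"
  shows "\<exists>r :: nat \<Rightarrow> nat. strict_mono r \<and> (\<forall>k\<in>K. mono (\<lambda>m. s (r m) k))"
  using assms
proof induction
  case empty
  show ?case by (rule exI[of _ id]) (simp add: strict_mono_def)
next
  case (insert k K)
  then obtain r :: "nat \<Rightarrow> nat" where r: "strict_mono r" "\<forall>k\<in>K. mono (\<lambda>m. s (r m) k)" by blast
  obtain r' :: "nat \<Rightarrow> nat" where r': "strict_mono r'" "mono (\<lambda>m. s (r (r' m)) k)"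
    using nat_seq_incseq_subseq[of "\<lambda>m. s (r m) k"] by blast
  have "mono r'" using r'(1) by (rule strict_mono_mono)
  then have "\<forall>l\<in>insert k K. mono (\<lambda>m. s (r (r' m)) l)"
    using r(2) r'(2) by (auto simp: mono_def)
  moreover have "strict_mono (\<lambda>m. r (r' m))"
    using r(1) r'(1) by (simp add: strict_mono_def)
  ultimately show ?case by (intro exI[of _ "\<lambda>m. r (r' m)"]) simp
qed

lemma dickson:
  fixes X :: "('n::finite \<Rightarrow> nat) set"
  obtains F where "finite F" "F \<subseteq> X" "\<And>x. x \<in> X \<Longrightarrow> \<exists>y\<in>F. y \<le> x"
proof
  let ?M = "{x \<in> X. \<forall>y\<in>X. y \<le> x \<longrightarrow> y = x}"
  show "?M \<subseteq> X" by blast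
  show "finite ?M"
  proof (rule ccontr)
    assume "infinite ?M"
    then obtain s :: "nat \<Rightarrow> 'n \<Rightarrow> nat" where s: "inj s" "range s \<subseteq> ?M"
      using infinite_countable_subset by blast
    obtain r :: "nat \<Rightarrow> nat" where r: "strict_mono r" "\<forall>k\<in>UNIV. mono (\<lambda>m. s (r m) k)"
      using nat_vector_seq_incseq_subseq[of UNIV s] by auto
    have "s (r 0) \<le> s (r 1)"
      using r(2) by (auto simp: le_fun_def mono_def)
    then have "s (r 0) = s (r 1)" using s(2) by blast
    then have "r 0 = r 1" using s(1) by (simp add: inj_eq)
    with r(1) show False by (metis strict_mono_eq zero_neq_one)
  qed
  show "\<exists>y\<in>?M. y \<le> x" if "x \<in> X" for x
    using that
  proof (induction "\<Sum>k\<in>UNIV. x k" arbitrary: x rule: less_induct)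
    case less
    show ?case
    proof (cases "x \<in> ?M")
      case False
      with less.prems obtain y where y: "y \<in> X" "y \<le> x" "y \<noteq> x" by blast
      then obtain k where "y k \<noteq> x k" by (auto simp: fun_eq_iff)
      with y(2) have "y k < x k" by (simp add: le_fun_def le_neq_implies_less)
      then have "sum y UNIV < sum x UNIV"
        using y(2) by (intro sum_strict_mono_ex1) (auto simp: le_fun_def)
      then show ?thesis using less.hyps y(1,2) by (meson order_trans)
    qed blast
  qed
qed


section \<open>The term order\<close>

lemma revlex_less_irrefl: "\<not> revlex_less v v"
  by (simp add: revlex_less_def)

lemma revlex_less_trans:
  assumes "revlex_less v u" "revlex_less u w"
  shows "revlex_less v w"
proof -
  obtain k where k: "v k > u k" "\<forall>l<k. v l = u l"
    using assms(1) by (auto simp: revlex_less_def)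
  obtain k' where k': "u k' > w k'" "\<forall>l<k'. u l = w l"
    using assms(2) by (auto simp: revlex_less_def)
  have "v (min k k') > w (min k k')"
    using k k' by (cases k k' rule: linorder_cases) (auto simp: min_def)
  moreover have "\<forall>l<min k k'. v l = w l" using k k' by simp
  ultimately show ?thesis unfolding revlex_less_def by blast
qed

lemma revlex_less_total:
  fixes v u :: "'n::{finite,linorder} \<Rightarrow> nat"
  assumes "v \<noteq> u"
  shows "revlex_less v u \<or> revlex_less u v"
proof -
  define k where "k = Min {k. v k \<noteq> u k}"
  have ne: "{k. v k \<noteq> u k} \<noteq> {}" using assms by auto
  then have "v k \<noteq> u k" unfolding k_def using Min_in[OF _ ne] by simp
  moreover have "\<forall>l<k. v l = u l" unfolding k_def using ne by (metis (mono_tags) Min_le finite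
        leD mem_Collect_eq)
  ultimately show ?thesis unfolding revlex_less_def by (metis nat_neq_iff)
qed

lemma exps_less_irrefl: "\<not> exps_less vs vs"
  by (simp add: exps_less_def revlex_less_irrefl)

lemma exps_ord_f_eq_iff:
  "vs \<noteq> [] \<Longrightarrow> us \<noteq> [] \<Longrightarrow> exps_ord_f vs = exps_ord_f us \<longleftrightarrow> length vs = length us"
  by (cases vs; cases us) (simp_all add: exps_ord_f_def)

lemma exps_less_trans:
  assumes "exps_less vs us" "exps_less us ws" and ne: "vs \<noteq> []" "us \<noteq> []" "ws \<noteq> []"
  shows "exps_less vs ws"
proof (cases "exps_deg vs = exps_deg us \<and> exps_deg us = exps_deg ws \<and>
    exps_ord_f vs = exps_ord_f us \<and> exps_ord_f us = exps_ord_f ws")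
  case True
  then have len: "length vs = length us" "length us = length ws"
    using ne exps_ord_f_eq_iff by blast+
  obtain j where j: "j < length vs" "\<forall>i<j. vs ! i = us ! i" "revlex_less (vs ! j) (us ! j)"
    using assms(1) True by (auto simp: exps_less_def)
  obtain j' where j': "j' < length us" "\<forall>i<j'. us ! i = ws ! i" "revlex_less (us ! j') (ws ! j')"
    using assms(2) True by (auto simp: exps_less_def)
  have "revlex_less (vs ! min j j') (ws ! min j j')"
    using j j' by (cases j j' rule: linorder_cases) (auto simp: min_def intro: revlex_less_trans)
  moreover have "min j j' < length vs" "\<forall>i<min j j'. vs ! i = ws ! i"
    using j j' by auto
  ultimately show ?thesis using True unfolding exps_less_def by metis
next
  case False
  then show ?thesis using assms(1,2) unfolding exps_less_def by auto
qed

lemma exps_less_total: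
  fixes vs us :: "('n::{finite,linorder} \<Rightarrow> nat) list"
  assumes "vs \<noteq> us" "vs \<noteq> []" "us \<noteq> []"
  shows "exps_less vs us \<or> exps_less us vs"
proof (cases "exps_deg vs = exps_deg us \<and> exps_ord_f vs = exps_ord_f us")
  case True
  then have len: "length vs = length us" using assms exps_ord_f_eq_iff by blast
  define j where "j = (LEAST j. j < length vs \<and> vs ! j \<noteq> us ! j)"
  have "\<exists>j. j < length vs \<and> vs ! j \<noteq> us ! j" using assms(1) len nth_equalityI by blast
  then have j: "j < length vs \<and> vs ! j \<noteq> us ! j"
    unfolding j_def by (rule LeastI_ex)
  moreover have "vs ! i = us ! i" if "i < j" for i
    using not_less_Least[of i "\<lambda>j. j < length vs \<and> vs ! j \<noteq> us ! j"] that j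
    by (auto simp: j_def[symmetric])
  ultimately show ?thesis
    using True len revlex_less_total[of "vs ! j" "us ! j"] unfolding exps_less_def by metis
next
  case False
  then show ?thesis unfolding exps_less_def by (meson nat_neq_iff)
qed

lemma exps_less_imp_deg_le: "exps_less vs us \<Longrightarrow> exps_deg vs \<le> exps_deg us"
  by (auto simp: exps_less_def)

lemma exps_deg_Cons: "us \<noteq> [] \<Longrightarrow> exps_deg (w # us) = (\<Sum>i\<in>UNIV. w i) + exps_deg us + 1"
  by (cases us) (simp_all add: exps_deg_def exps_ord_f_def)

lemma exps_less_Cons:
  assumes "exps_less us us'" "us \<noteq> []" "us' \<noteq> []"
  shows "exps_less (w # us) (w # us')"
proof -
  have "\<exists>j<length (w # us). (\<forall>i<j. (w # us) ! i = (w # us') ! i) \<and>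
      revlex_less ((w # us) ! j) ((w # us') ! j)"
    if "j < length us" "\<forall>i<j. us ! i = us' ! i" "revlex_less (us ! j) (us' ! j)" for j
    using that by (intro exI[of _ "Suc j"]) (auto simp: less_Suc_eq_0_disj)
  moreover have "exps_ord_f (w # us) = Suc (exps_ord_f us)"
    "exps_ord_f (w # us') = Suc (exps_ord_f us')"
    using assms by (cases us; cases us'; simp add: exps_ord_f_def)+
  ultimately show ?thesis
    using assms unfolding exps_less_def by (auto simp: exps_deg_Cons)
qed

text \<open>
  The order on the monomials of the free module, where \<open>(vs, i)\<close> stands for the monomial with
  exponents \<open>vs\<close> times the \<open>i\<close>-th basis element. On pairs with \<open>vs \<noteq> []\<close> it is a strict
  total order.
\<close>

definition exps_pair_less ::
  "('n::{finite,linorder} \<Rightarrow> nat) list \<times> nat \<Rightarrow> ('n \<Rightarrow> nat) list \<times> nat \<Rightarrow> bool" where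
  "exps_pair_less = (\<lambda>(vs, i) (us, j). exps_less vs us \<or> vs = us \<and> i < j)"

lemma exps_pair_less_trans:
  assumes "exps_pair_less a b" "exps_pair_less b c" "fst a \<noteq> []" "fst b \<noteq> []" "fst c \<noteq> []"
  shows "exps_pair_less a c"
  using assms by (cases a; cases b; cases c) (auto simp: exps_pair_less_def intro: exps_less_trans)

lemma exps_pair_less_asym:
  assumes "exps_pair_less a b" "exps_pair_less b a" "fst a \<noteq> []" "fst b \<noteq> []"
  shows False
  using exps_pair_less_trans[OF assms(1,2) assms(3,4,3)]
  by (cases a) (simp add: exps_pair_less_def exps_less_irrefl)

lemma exps_pair_less_total:
  assumes "a \<noteq> b" "fst a \<noteq> []" "fst b \<noteq> []"
  shows "exps_pair_less a b \<or> exps_pair_less b a"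
  using assms exps_less_total[of "fst a" "fst b"]
  by (cases a; cases b) (auto simp: exps_pair_less_def)

lemma monomial_less_iff:
  assumes "valid_exps CARD('p) vs" "valid_exps CARD('p) us"
  shows "monomial_less (monomial_product vs :: ('p::prime_card, 'n::{finite,linorder}) alg)
    (monomial_product us) \<longleftrightarrow> exps_less vs us"
proof -
  have mem: "monomial_product ws \<in> (alg_monomials :: ('p, 'n) alg set) \<longleftrightarrow> valid_exps CARD('p) ws"
    for ws :: "('n \<Rightarrow> nat) list"
    using monomial_product_invalid[of ws]
    by (auto simp: alg_monomials_def) (metis (mono_tags, lifting) alg_monomials_def
        alg_monomials_eq DiffD2 image_eqI mem_Collect_eq singletonI)
  have inj: "ws = ws'" if "valid_exps CARD('p) ws" "monomial_product ws' =
      (monomial_product ws :: ('p, 'n) alg)" for ws ws'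
    using that mem inj_onD[OF inj_on_monomial_product] by (metis mem_Collect_eq)
  show ?thesis
    unfolding monomial_less_def using assms mem inj by metis
qed


section \<open>Leading monomials\<close>

text \<open>
  The largest monomial of \<open>g\<close> has exponents \<open>vs\<close> and sits at the \<open>i\<close>-th basis element. Working with
  exponent lists instead of elements of the algebra makes the comparison of tails below immediate.
\<close>

definition is_lead ::
  "nat \<Rightarrow> (nat \<Rightarrow> ('p::prime_card, 'n::{finite,linorder}) alg) \<Rightarrow> ('n \<Rightarrow> nat) list \<Rightarrow> nat \<Rightarrow> bool" where
  "is_lead t g vs i \<longleftrightarrow> i < t \<and> mon_coeff (g i) vs \<noteq> 0 \<and>
     (\<forall>us j. j < t \<longrightarrow> mon_coeff (g j) us \<noteq> 0 \<longrightarrow> (us, j) \<noteq> (vs, i) \<longrightarrow>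
       exps_pair_less (us, j) (vs, i))"

lemma lead_exists:
  fixes g :: "nat \<Rightarrow> ('p::prime_card, 'n::{finite,linorder}) alg"
  assumes "g \<in> free_module t" "g \<noteq> 0"
  obtains vs i where "is_lead t g vs i"
proof -
  let ?A = "\<Union>i\<in>{..<t}. (\<lambda>vs. (vs, i)) ` {vs. mon_coeff (g i) vs \<noteq> 0}"
  have "finite ?A" by (simp add: finite_mon_coeff)
  moreover have "?A \<noteq> {}"
  proof -
    obtain i where i: "g i \<noteq> 0" using assms(2) by (auto simp: fun_eq_iff)
    then have "i < t" using assms(1) by (auto simp: free_module_def not_less[symmetric])
    moreover obtain vs where "mon_coeff (g i) vs \<noteq> 0" using i by (rule mon_coeff_nonzero_ex)
    ultimately show ?thesis by blast
  qed
  moreover have ne: "fst a \<noteq> []" if "a \<in> ?A" for a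
    using that by (auto simp: mon_coeff_Nil)
  then have "transp_on ?A exps_pair_less"
    unfolding transp_on_def by (meson exps_pair_less_trans)
  moreover have "totalp_on ?A exps_pair_less"
    unfolding totalp_on_def using ne exps_pair_less_total by meson
  ultimately obtain a where "a \<in> ?A" "\<forall>b\<in>?A. b \<noteq> a \<longrightarrow> exps_pair_less b a"
    using Finite_Set.bex_greatest_element[of ?A exps_pair_less] by blast
  then have "is_lead t g (fst a) (snd a)"
    by (auto simp: is_lead_def)
  then show thesis by (rule that)
qed

lemma is_lead_valid:
  fixes g :: "nat \<Rightarrow> ('p::prime_card, 'n::{finite,linorder}) alg"
  shows "is_lead t g vs i \<Longrightarrow> valid_exps CARD('p) vs"
  by (auto simp: is_lead_def intro: mon_coeff_valid)

lemma initial_term_lead: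
  fixes g :: "nat \<Rightarrow> ('p::prime_card, 'n::{finite,linorder}) alg"
  assumes lead: "is_lead t g vs i"
  shows "initial_term t g =
    (\<lambda>j. if j = i then alg_scale (mon_coeff (g i) vs) (monomial_product vs) else 0)"
proof -
  note val = is_lead_valid[OF lead]
  have supp: "module_support t g =
      {(monomial_product us, j) | us j. j < t \<and> mon_coeff (g j) us \<noteq> 0}" (is "_ = ?S")
    unfolding module_support_def alg_monomials_eq
    using alg_coeff_monomial_product mon_coeff_valid by fastforce
  have less: "module_monomial_less (monomial_product us :: ('p, 'n) alg, j) (monomial_product us', j') \<longleftrightarrow>
      exps_pair_less (us, j) (us', j')"
    if "valid_exps CARD('p) us" "valid_exps CARD('p) us'" for us us' j j'
  proof -
    have "monomial_product us = (monomial_product us' :: ('p, 'n) alg) \<longleftrightarrow> us = us'"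
      using that inj_onD[OF inj_on_monomial_product] by blast
    then show ?thesis
      using monomial_less_iff[OF that]
      by (simp add: module_monomial_less_def exps_pair_less_def)
  qed
  have "initial_monomial t g = (monomial_product vs, i)"
    unfolding initial_monomial_def supp
  proof (rule the_equality)
    show "(monomial_product vs, i) \<in> ?S \<and> (\<forall>m'\<in>?S. m' \<noteq> (monomial_product vs, i) \<longrightarrow>
        module_monomial_less m' (monomial_product vs, i))"
    proof (intro conjI ballI impI)
      show "(monomial_product vs, i) \<in> ?S" using lead by (auto simp: is_lead_def)
      fix m' assume "m' \<in> ?S" and ne: "m' \<noteq> (monomial_product vs, i)"
      then obtain us j where us: "m' = (monomial_product us, j)" "j < t" "mon_coeff (g j) us \<noteq> 0"
        by blast
      with ne have "(us, j) \<noteq> (vs, i)" by blast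
      with lead us have "exps_pair_less (us, j) (vs, i)" by (simp add: is_lead_def)
      then show "module_monomial_less m' (monomial_product vs, i)"
        using us val by (simp add: less mon_coeff_valid)
    qed
  next
    fix m assume m: "m \<in> ?S \<and> (\<forall>m'\<in>?S. m' \<noteq> m \<longrightarrow> module_monomial_less m' m)"
    then obtain us j where us: "m = (monomial_product us, j)" "j < t" "mon_coeff (g j) us \<noteq> 0"
      by blast
    show "m = (monomial_product vs, i)"
    proof (rule ccontr)
      assume ne: "m \<noteq> (monomial_product vs, i)"
      have "(monomial_product vs, i) \<in> ?S" using lead by (auto simp: is_lead_def)
      from bspec[OF conjunct2[OF m] this] ne
      have "module_monomial_less (monomial_product vs, i) m" by (simp only: eq_commute simp_thms)
      then have 1: "exps_pair_less (vs, i) (us, j)"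
        using us val by (simp add: less mon_coeff_valid)
      have 2: "exps_pair_less (us, j) (vs, i)"
        using lead us ne by (auto simp: is_lead_def)
      have "vs \<noteq> []" "us \<noteq> []"
        using val us mon_coeff_Nil by (auto simp: valid_exps_Nil)
      with exps_pair_less_asym[OF 1 2] show False by simp
    qed
  qed
  then show ?thesis
    using val by (simp add: initial_term_def alg_coeff_monomial_product cong: if_cong)
qed


section \<open>Submodules of the free module\<close>

lemma free_module_left_submodule: "left_submodule t (free_module t)"
  by (auto simp: left_submodule_def free_module_def)

lemma left_submodule_hull:
  fixes A :: "(nat \<Rightarrow> 'a::ring_1) set"
  assumes "A \<subseteq> free_module t"
  shows "left_submodule t (left_submodule t hull A)"
proof -
  have "left_submodule t hull A \<subseteq> free_module t"
    using assms free_module_left_submodule by (rule hull_minimal)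
  then show ?thesis
    unfolding hull_def left_submodule_def by auto
qed

lemma left_submodule_add: "left_submodule t N \<Longrightarrow> u \<in> N \<Longrightarrow> v \<in> N \<Longrightarrow> u + v \<in> N"
  and left_submodule_mult: "left_submodule t N \<Longrightarrow> u \<in> N \<Longrightarrow> (\<lambda>i. a * u i) \<in> N"
  and left_submodule_0: "left_submodule t N \<Longrightarrow> 0 \<in> N"
  and left_submodule_free: "left_submodule t N \<Longrightarrow> N \<subseteq> free_module t"
  by (simp_all add: left_submodule_def)

lemma left_submoduleI:
  fixes N :: "(nat \<Rightarrow> ('p::prime_card, 'n) alg) set"
  assumes "N \<subseteq> free_module t" and "0 \<in> N"
    and add: "\<And>u v. u \<in> N \<Longrightarrow> v \<in> N \<Longrightarrow> u + v \<in> N"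
    and const: "\<And>c u. u \<in> N \<Longrightarrow> (\<lambda>i. alg_const c * u i) \<in> N"
    and x: "\<And>k u. u \<in> N \<Longrightarrow> (\<lambda>i. alg_x k * u i) \<in> N"
    and f: "\<And>u. u \<in> N \<Longrightarrow> (\<lambda>i. alg_f * u i) \<in> N"
  shows "left_submodule t N"
proof -
  have "\<forall>u\<in>N. (\<lambda>i. a * u i) \<in> N" for a
  proof (induction a rule: alg_induct)
    case (const c)
    then show ?case using assms(4) by blast
  next
    case (x k a)
    then show ?case using assms(5)[of "\<lambda>i. a * u i" k for u] by (simp add: mult.assoc)
  next
    case (f a)
    then show ?case using assms(6)[of "\<lambda>i. a * u i" for u] by (simp add: mult.assoc)
  next
    case (add a b)
    then show ?case
      using assms(3)[of "\<lambda>i. a * u i" "\<lambda>i. b * u i" for u]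
      by (simp add: distrib_right plus_fun_def)
  qed
  with assms show ?thesis unfolding left_submodule_def by blast
qed


section \<open>Splitting off bounded tails\<close>

text \<open>
  For a monomial with exponents \<open>w # us\<close>, \<open>us \<noteq> []\<close>, that is \<open>x^w f\<close> times the monomial with exponents
  \<open>us\<close>, call \<open>us\<close> its tail. The next predicate says that all tails in \<open>m\<close> have degree at most \<open>D\<close>;
  monomials without \<open>f\<close> have no tail and are not restricted. Left multiplication by a variable
  only changes \<open>w\<close> or gives zero, so it preserves this bound.
\<close>

definition tails_bounded :: "nat \<Rightarrow> (nat \<Rightarrow> ('p::prime_card, 'n::{finite,linorder}) alg) \<Rightarrow> bool" where
  "tails_bounded D m \<longleftrightarrow>
     (\<forall>i w us. us \<noteq> [] \<longrightarrow> mon_coeff (m i) (w # us) \<noteq> 0 \<longrightarrow> exps_deg us \<le> D)"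

text \<open>
  The element \<open>h\<close> has the form \<open>\<Sum>\<^sub>w x^w f n\<^sub>w\<close> with all \<open>n\<^sub>w\<close> in \<open>N\<close>, expressed through coefficients.
  For \<open>us = []\<close> the equation says that \<open>h\<close> contains no monomial without \<open>f\<close>, since \<^const>\<open>mon_coeff\<close>
  vanishes on the empty list. If some entry of \<open>w\<close> is at least \<open>p\<close>, the left-hand side also vanishes for
  \<open>us \<noteq> []\<close>, so \<open>n\<^sub>w\<close> is forced to be zero and the sum is finite.
\<close>

definition tails_in ::
  "(nat \<Rightarrow> ('p::prime_card, 'n::{finite,linorder}) alg) set \<Rightarrow> (nat \<Rightarrow> ('p, 'n) alg) \<Rightarrow> bool" where
  "tails_in N h \<longleftrightarrow>
     (\<exists>n. (\<forall>w. n w \<in> N) \<and> (\<forall>i w us. mon_coeff (h i) (w # us) = mon_coeff (n w i) us))"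

lemma tails_bounded_0: "tails_bounded D 0"
  by (simp add: tails_bounded_def mon_coeff_0)

lemma tails_bounded_add: "tails_bounded D u \<Longrightarrow> tails_bounded D v \<Longrightarrow> tails_bounded D (u + v)"
  unfolding tails_bounded_def by (metis add.right_neutral mon_coeff_add plus_fun_apply)

lemma tails_bounded_const: "tails_bounded D u \<Longrightarrow> tails_bounded D (\<lambda>i. alg_const c * u i)"
  by (auto simp: tails_bounded_def mon_coeff_scale)

lemma tails_bounded_x: "tails_bounded D u \<Longrightarrow> tails_bounded D (\<lambda>i. alg_x k * u i)"
  by (auto simp: tails_bounded_def mon_coeff_x split: if_splits)

lemma tails_in_0: "left_submodule t N \<Longrightarrow> tails_in N 0"
  unfolding tails_in_def
  by (intro exI[of _ "\<lambda>_. 0"]) (simp add: left_submodule_0 mon_coeff_0)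

lemma tails_in_add:
  assumes "left_submodule t N" "tails_in N u" "tails_in N v"
  shows "tails_in N (u + v)"
proof -
  obtain n n' where "\<forall>w. n w \<in> N" "\<forall>i w us. mon_coeff (u i) (w # us) = mon_coeff (n w i) us"
    "\<forall>w. n' w \<in> N" "\<forall>i w us. mon_coeff (v i) (w # us) = mon_coeff (n' w i) us"
    using assms(2,3) unfolding tails_in_def by blast
  then show ?thesis
    unfolding tails_in_def using left_submodule_add[OF assms(1)]
    by (intro exI[of _ "\<lambda>w. n w + n' w"]) (simp add: mon_coeff_add)
qed

lemma tails_in_const:
  assumes "left_submodule t N" "tails_in N u"
  shows "tails_in N (\<lambda>i. alg_const c * u i)"
proof -
  obtain n where "\<forall>w. n w \<in> N" "\<forall>i w us. mon_coeff (u i) (w # us) = mon_coeff (n w i) us"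
    using assms(2) unfolding tails_in_def by blast
  then show ?thesis
    unfolding tails_in_def using left_submodule_mult[OF assms(1)]
    by (intro exI[of _ "\<lambda>w i. alg_const c * n w i"]) (simp add: mon_coeff_scale)
qed

lemma tails_in_f:
  assumes "left_submodule t N" "u \<in> N"
  shows "tails_in N (\<lambda>i. alg_f * u i)"
  unfolding tails_in_def using assms left_submodule_0[OF assms(1)]
  by (intro exI[of _ "\<lambda>w. if w = (\<lambda>_. 0) then u else 0"]) (simp add: mon_coeff_f mon_coeff_0)

lemma tails_in_x:
  fixes N :: "(nat \<Rightarrow> ('p::prime_card, 'n::{finite,linorder}) alg) set"
  assumes "left_submodule t N" "tails_in N u"
  shows "tails_in N (\<lambda>i. alg_x k * u i)"
proof -
  obtain n where n: "\<forall>w. n w \<in> N" "\<forall>i w us. mon_coeff (u i) (w # us) = mon_coeff (n w i) us"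
    using assms(2) unfolding tails_in_def by blast
  \<comment> \<open>Multiplication by \<open>x\<^sub>k\<close> moves \<open>n\<^sub>w\<close> to the index \<open>w\<close> raised by one at \<open>k\<close>, or kills \<open>x^w f n\<^sub>w\<close>.\<close>
  define n' where "n' w = (if w k > 0 \<and> w k < CARD('p) then n (w(k := w k - 1)) else 0)" for w
  have "mon_coeff (alg_x k * u i) (w # us) = mon_coeff (n' w i) us" for i w us
    using n(2) by (auto simp: n'_def mon_coeff_x mon_coeff_0 mon_coeff_Nil)
  moreover have "n' w \<in> N" for w
    using n(1) left_submodule_0[OF assms(1)] by (simp add: n'_def)
  ultimately show ?thesis unfolding tails_in_def by blast
qed

text \<open>
  If the generators of \<open>N\<close> have tails of degree at most \<open>D\<close>, then every element of \<open>N\<close> is a sum of an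
  element with such tails and an element of \<open>\<Sum>\<^sub>w x^w f N\<close>: these sums form a submodule, because
  multiplication by \<open>f\<close> maps all of \<open>N\<close> into the second part.
\<close>

lemma tails_decomposition:
  fixes G :: "(nat \<Rightarrow> ('p::prime_card, 'n::{finite,linorder}) alg) set"
  assumes G: "G \<subseteq> free_module t" "\<And>g. g \<in> G \<Longrightarrow> tails_bounded D g"
    and g: "g \<in> left_submodule t hull G"
  obtains m h where "g = m + h" "tails_bounded D m" "tails_in (left_submodule t hull G) h"
proof -
  let ?N = "left_submodule t hull G"
  note N = left_submodule_hull[OF G(1)]
  let ?Z = "{g \<in> ?N. \<exists>m h. g = m + h \<and> tails_bounded D m \<and> tails_in ?N h}"
  have dist: "(\<lambda>i. a * (m + h) i) = (\<lambda>i. a * m i) + (\<lambda>i. a * h i)"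
    for a :: "('p, 'n) alg" and m h
    by (simp add: fun_eq_iff distrib_left)
  have "left_submodule t ?Z"
  proof (rule left_submoduleI)
    show "?Z \<subseteq> free_module t" using left_submodule_free[OF N] by blast
    have "(0 :: nat \<Rightarrow> ('p, 'n) alg) = 0 + 0" by simp
    then show "0 \<in> ?Z"
      using left_submodule_0[OF N] tails_bounded_0 tails_in_0[OF N] by blast
  next
    fix u v assume "u \<in> ?Z" "v \<in> ?Z"
    then obtain m h m' h' where "u = m + h" "tails_bounded D m" "tails_in ?N h"
      "v = m' + h'" "tails_bounded D m'" "tails_in ?N h'" "u \<in> ?N" "v \<in> ?N" by blast
    moreover from this have "u + v = (m + m') + (h + h')" by (simp add: algebra_simps)
    ultimately show "u + v \<in> ?Z"
      using tails_bounded_add tails_in_add[OF N] left_submodule_add[OF N] by blast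
  next
    fix c u assume "u \<in> ?Z"
    then show "(\<lambda>i. alg_const c * u i) \<in> ?Z"
      using tails_bounded_const tails_in_const[OF N] left_submodule_mult[OF N] dist by blast
  next
    fix k u assume "u \<in> ?Z"
    then show "(\<lambda>i. alg_x k * u i) \<in> ?Z"
      using tails_bounded_x tails_in_x[OF N] left_submodule_mult[OF N] dist by blast
  next
    fix u assume "u \<in> ?Z"
    then have u: "u \<in> ?N" by blast
    have "(\<lambda>i. alg_f * u i) = 0 + (\<lambda>i. alg_f * u i)" by simp
    then show "(\<lambda>i. alg_f * u i) \<in> ?Z"
      using tails_bounded_0 tails_in_f[OF N u] left_submodule_mult[OF N u] by blast
  qed
  moreover have "G \<subseteq> ?Z"
  proof
    fix u assume "u \<in> G"
    moreover have "u = u + 0" by simp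
    ultimately show "u \<in> ?Z"
      using G(2) tails_in_0[OF N] hull_inc[of u G] by blast
  qed
  ultimately have "?N \<subseteq> ?Z" using hull_minimal by blast
  with g that show thesis by blast
qed

lemma tails_bounded_finite:
  fixes G :: "(nat \<Rightarrow> ('p::prime_card, 'n::{finite,linorder}) alg) set"
  assumes "finite G" "G \<subseteq> free_module t"
  obtains D where "\<And>g. g \<in> G \<Longrightarrow> tails_bounded D g"
proof -
  let ?S = "\<Union>g\<in>G. \<Union>i\<in>{..<t}. {vs. mon_coeff (g i) vs \<noteq> 0}"
  have fin: "finite ((\<lambda>vs. exps_deg (tl vs)) ` ?S)"
    using assms(1) by (simp add: finite_mon_coeff)
  have "tails_bounded (Max ((\<lambda>vs. exps_deg (tl vs)) ` ?S)) g" if "g \<in> G" for g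
    unfolding tails_bounded_def
  proof (intro allI impI)
    fix i w and us :: "('n \<Rightarrow> nat) list"
    assume *: "mon_coeff (g i) (w # us) \<noteq> 0"
    have "i < t"
    proof (rule ccontr)
      assume "\<not> i < t"
      then have "g i = 0" using that assms(2) by (auto simp: free_module_def)
      with * show False by (simp add: mon_coeff_0)
    qed
    with * that have "exps_deg (tl (w # us)) \<in> (\<lambda>vs. exps_deg (tl vs)) ` ?S" by blast
    with fin show "exps_deg us \<le> Max ((\<lambda>vs. exps_deg (tl vs)) ` ?S)" by simp
  qed
  then show thesis by (rule that)
qed

text \<open>
  A leading monomial whose tail exceeds the bound \<open>D\<close> does not occur in
  \<open>m\<close>, so it comes from \<open>x^w f n\<^sub>w\<close> in \<open>h\<close>. Its tail is then the leading monomial of \<open>n\<^sub>w\<close>: a larger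
  monomial of \<open>n\<^sub>w\<close> would have at least the same degree, hence would also exceed \<open>D\<close>, and so
  would survive in \<open>m + h\<close> in front of the leading monomial.
\<close>

lemma is_lead_tail:
  fixes N :: "(nat \<Rightarrow> ('p::prime_card, 'n::{finite,linorder}) alg) set"
  assumes lead: "is_lead t (m + h) (w # us) i" and us: "us \<noteq> []" "exps_deg us > D"
    and m: "tails_bounded D m" and h: "tails_in N h"
  obtains n where "n \<in> N" "is_lead t n us i"
proof -
  obtain n where n: "\<forall>w. n w \<in> N" "\<forall>i w us. mon_coeff (h i) (w # us) = mon_coeff (n w i) us"
    using h unfolding tails_in_def by blast
  have coeff: "mon_coeff ((m + h) j) (w # us') = mon_coeff (n w j) us'"
    if "us' \<noteq> []" "exps_deg us' > D" for j us'
  proof -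
    have "mon_coeff (m j) (w # us') = 0" using m that unfolding tails_bounded_def by fastforce
    then show ?thesis using n(2) by (simp add: mon_coeff_add)
  qed
  have "is_lead t (n w) us i"
    unfolding is_lead_def
  proof (intro conjI allI impI)
    show "i < t" "mon_coeff (n w i) us \<noteq> 0"
      using lead coeff[OF us] by (auto simp: is_lead_def)
    fix us' j assume j: "j < t" "mon_coeff (n w j) us' \<noteq> 0" "(us', j) \<noteq> (us, i)"
    then have ne: "us' \<noteq> []" by (auto simp: mon_coeff_Nil)
    show "exps_pair_less (us', j) (us, i)"
    proof (rule ccontr)
      assume "\<not> ?thesis"
      then have gt: "exps_pair_less (us, i) (us', j)"
        using exps_pair_less_total[of "(us', j)" "(us, i)"] j(3) ne us(1) by auto
      then have "exps_deg us \<le> exps_deg us'"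
        by (auto simp: exps_pair_less_def dest: exps_less_imp_deg_le)
      then have "mon_coeff ((m + h) j) (w # us') \<noteq> 0"
        using coeff[OF ne] us(2) j(2) by simp
      then have 1: "exps_pair_less (w # us', j) (w # us, i)"
        using lead j by (auto simp: is_lead_def)
      have 2: "exps_pair_less (w # us, i) (w # us', j)"
        using gt exps_less_Cons[OF _ us(1) ne] by (auto simp: exps_pair_less_def)
      from exps_pair_less_asym[OF 1 2] show False by simp
    qed
  qed
  then show thesis using n(1) that by blast
qed


section \<open>Generators of the initial submodule\<close>

text \<open>The monomial with exponents \<open>vs\<close> times the \<open>i\<close>-th basis element, as an element of the free module.\<close>

definition mon_vector ::
  "('n::{finite,linorder} \<Rightarrow> nat) list \<times> nat \<Rightarrow> nat \<Rightarrow> ('p::prime_card, 'n) alg" where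
  "mon_vector = (\<lambda>(vs, i) j. if j = i then monomial_product vs else 0)"

text \<open>The monomials that are leading monomials of elements of \<open>N\<close>.\<close>

definition leads ::
  "nat \<Rightarrow> (nat \<Rightarrow> ('p::prime_card, 'n::{finite,linorder}) alg) set \<Rightarrow> (('n \<Rightarrow> nat) list \<times> nat) set" where
  "leads t N = {(vs, i). \<exists>g\<in>N. is_lead t g vs i}"

lemma mon_vector_free: "i < t \<Longrightarrow> mon_vector (vs, i) \<in> free_module t"
  by (simp add: mon_vector_def free_module_def)

lemma leads_less: "(vs, i) \<in> leads t N \<Longrightarrow> i < t"
  by (auto simp: leads_def is_lead_def)

lemma leads_free: "mon_vector ` leads t N \<subseteq> free_module t"
proof clarify
  fix vs i assume "(vs, i) \<in> leads t N"
  then show "mon_vector (vs, i) \<in> free_module t"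
    by (intro mon_vector_free leads_less)
qed

lemma initial_submodule_eq:
  fixes N :: "(nat \<Rightarrow> ('p::prime_card, 'n::{finite,linorder}) alg) set"
  assumes N: "N \<subseteq> free_module t"
  shows "initial_submodule t N = left_submodule t hull (mon_vector ` leads t N)" (is "_ = ?H")
proof
  have term_eq: "initial_term t g = (\<lambda>j. alg_const (mon_coeff (g i) vs) * mon_vector (vs, i) j)"
    if "is_lead t g vs i" for g :: "nat \<Rightarrow> ('p, 'n) alg" and vs i
    by (simp add: initial_term_lead[OF that] fun_eq_iff mon_vector_def alg_scale_def)
  have H: "left_submodule t ?H" by (rule left_submodule_hull[OF leads_free])
  have in_H: "initial_term t g \<in> ?H" if g: "g \<in> N - {0}" for g
  proof -
    obtain vs i where lead: "is_lead t g vs i" using g N lead_exists[of g t] by blast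
    then have "mon_vector (vs, i) \<in> ?H"
      using g by (intro hull_inc imageI) (auto simp: leads_def)
    then show ?thesis
      unfolding term_eq[OF lead] by (rule left_submodule_mult[OF H])
  qed
  then show "initial_submodule t N \<subseteq> ?H"
    unfolding initial_submodule_def using H by (intro hull_minimal) auto
  have "initial_term t ` (N - {0}) \<subseteq> free_module t"
    using in_H left_submodule_free[OF H] by blast
  then have I: "left_submodule t (initial_submodule t N)"
    unfolding initial_submodule_def by (rule left_submodule_hull)
  have "mon_vector (vs, i) \<in> initial_submodule t N" if vs: "(vs, i) \<in> leads t N" for vs i
  proof -
    obtain g where g: "g \<in> N" and lead: "is_lead t g vs i" using vs by (auto simp: leads_def)
    then have c: "mon_coeff (g i) vs \<noteq> 0" by (simp add: is_lead_def)
    then have "g \<noteq> 0" by (auto simp: mon_coeff_0)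
    with g have "initial_term t g \<in> initial_submodule t N"
      unfolding initial_submodule_def by (intro hull_inc) auto
    from left_submodule_mult[OF I this, of "alg_const (inverse (mon_coeff (g i) vs))"]
    show ?thesis
      using c by (simp add: term_eq[OF lead] mult.assoc[symmetric] alg_const_mult[symmetric]
          alg_const_1)
  qed
  then show "?H \<subseteq> initial_submodule t N"
    by (intro hull_minimal I) auto
qed

lemma finite_exps_deg_le: "finite {us :: ('n::finite \<Rightarrow> nat) list. exps_deg us \<le> D}"
proof (rule finite_subset)
  let ?B = "{v :: 'n \<Rightarrow> nat. \<forall>i. v i \<le> D}"
  have "?B = (UNIV \<rightarrow>\<^sub>E {..D})" by (auto simp: PiE_def)
  then have "finite ?B" by (simp add: finite_PiE)
  then show "finite {us. set us \<subseteq> ?B \<and> length us \<le> D + 1}"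
    by (rule finite_lists_length_le)
  show "{us :: ('n \<Rightarrow> nat) list. exps_deg us \<le> D} \<subseteq> {us. set us \<subseteq> ?B \<and> length us \<le> D + 1}"
  proof (clarsimp, intro conjI subsetI CollectI allI)
    fix us :: "('n \<Rightarrow> nat) list" assume us: "exps_deg us \<le> D"
    then show "length us \<le> Suc D" by (simp add: exps_deg_def exps_ord_f_def)
    fix v i assume "v \<in> set us"
    have "v i \<le> sum v UNIV" by (rule member_le_sum) auto
    also have "\<dots> \<le> (\<Sum>v\<leftarrow>us. sum v UNIV)"
      using \<open>v \<in> set us\<close> by (intro member_le_sum_list) auto
    finally show "v i \<le> D" using us by (simp add: exps_deg_def)
  qed
qed

text \<open>
  Validity bounds the first exponent vector once there is a tail, so bounding the degree of the
  tail leaves only finitely many monomials.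
\<close>

lemma finite_leads_tail_deg_le:
  fixes N :: "(nat \<Rightarrow> ('p::prime_card, 'n::{finite,linorder}) alg) set"
  shows "finite {(vs, i) \<in> leads t N. tl vs \<noteq> [] \<and> exps_deg (tl vs) \<le> D}" (is "finite ?S")
proof (rule finite_subset)
  let ?B = "{w :: 'n \<Rightarrow> nat. \<forall>i. w i < CARD('p)}"
  have "?B = (UNIV \<rightarrow>\<^sub>E {..<CARD('p)})" by (auto simp: PiE_def)
  then have "finite ?B" by (simp add: finite_PiE)
  then show "finite ((\<lambda>((w, us), i). (w # us, i)) ` ((?B \<times> {us. exps_deg us \<le> D}) \<times> {..<t}))"
    by (intro finite_imageI finite_cartesian_product finite_exps_deg_le finite_lessThan)
  show "?S \<subseteq> (\<lambda>((w, us), i). (w # us, i)) ` ((?B \<times> {us. exps_deg us \<le> D}) \<times> {..<t})"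
  proof (clarify)
    fix vs i assume *: "(vs, i) \<in> leads t N" "tl vs \<noteq> []" "exps_deg (tl vs) \<le> D"
    then have val: "valid_exps CARD('p) vs" and "i < t"
      by (auto simp: leads_def is_lead_def intro: mon_coeff_valid)
    then obtain w us where vs: "vs = w # us" by (cases vs) (auto simp: valid_exps_Nil)
    have "w \<in> ?B" "exps_deg us \<le> D"
      using val * by (auto simp: vs valid_exps_Cons)
    with \<open>i < t\<close> vs
    show "(vs, i) \<in> (\<lambda>((w, us), i). (w # us, i)) ` ((?B \<times> {us. exps_deg us \<le> D}) \<times> {..<t})"
      by (intro image_eqI[of _ _ "((w, us), i)"]) simp_all
  qed
qed

lemma initial_submodule_finitely_generated:
  fixes N :: "(nat \<Rightarrow> ('p::prime_card, 'n::{finite,linorder}) alg) set"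
  assumes "left_submodule t N" and "finitely_generated t N"
  shows "finitely_generated t (initial_submodule t N)"
proof -
  obtain G where G: "finite G" "G \<subseteq> free_module t" and N: "N = left_submodule t hull G"
    using assms(2) by (auto simp: finitely_generated_def)
  obtain D where D: "\<And>g. g \<in> G \<Longrightarrow> tails_bounded D g"
    using tails_bounded_finite[OF G] by blast
  have "\<exists>F. finite F \<and> F \<subseteq> {v. ([v], i) \<in> leads t N} \<and>
      (\<forall>v. ([v], i) \<in> leads t N \<longrightarrow> (\<exists>u\<in>F. u \<le> v))" for i
    using dickson[of "{v. ([v], i) \<in> leads t N}"] by (metis mem_Collect_eq)
  then obtain F where F: "\<And>i. finite (F i)" "\<And>i. F i \<subseteq> {v. ([v], i) \<in> leads t N}"
    "\<And>i v. ([v], i) \<in> leads t N \<Longrightarrow> \<exists>u\<in>F i. u \<le> v"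
    by metis
  \<comment> \<open>The generators: enough leading monomials without \<open>f\<close> to divide all of them, and all those
    with a tail of degree at most \<open>D\<close>.\<close>
  define L where "L = (\<Union>i\<in>{..<t}. (\<lambda>v. ([v], i)) ` F i) \<union>
    {(vs, i) \<in> leads t N. tl vs \<noteq> [] \<and> exps_deg (tl vs) \<le> D}"
  have "finite L"
    unfolding L_def using F(1) finite_leads_tail_deg_le by blast
  have sub: "L \<subseteq> leads t N"
    unfolding L_def using F(2) by blast
  have free: "mon_vector ` L \<subseteq> (free_module t :: (nat \<Rightarrow> ('p, 'n) alg) set)"
    using sub leads_free by blast
  let ?H = "left_submodule t hull (mon_vector ` L) :: (nat \<Rightarrow> ('p, 'n) alg) set"
  note H = left_submodule_hull[OF free]
  have "mon_vector (vs, i) \<in> ?H" if "(vs, i) \<in> leads t N" for vs i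
    using that
  proof (induction vs)
    case Nil
    then show ?case by (auto simp: leads_def is_lead_def mon_coeff_Nil)
  next
    case (Cons w us)
    show ?case
    proof (cases "us = []")
      case True
      then obtain u where u: "u \<in> F i" "u \<le> w" using F(3) Cons.prems by blast
      then have "([u], i) \<in> L" using leads_less[OF Cons.prems] by (auto simp: L_def)
      then have "mon_vector ([u], i) \<in> ?H" by (intro hull_inc imageI)
      from left_submodule_mult[OF H this, of "x_power (\<lambda>k. w k - u k)"]
      have "(\<lambda>j. x_power (\<lambda>k. w k - u k) * mon_vector ([u], i) j) \<in> ?H" .
      moreover have "(\<lambda>k. w k - u k + u k) = w" using u(2) by (auto simp: le_fun_def)
      then have "(\<lambda>j. x_power (\<lambda>k. w k - u k) * mon_vector ([u], i) j) =
          (mon_vector ([w], i) :: nat \<Rightarrow> ('p, 'n) alg)"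
        by (simp add: mon_vector_def x_power_add fun_eq_iff)
      ultimately show ?thesis using True by simp
    next
      case ne: False
      show ?thesis
      proof (cases "exps_deg us \<le> D")
        case True
        then have "(w # us, i) \<in> L" using Cons.prems ne by (simp add: L_def)
        then show ?thesis by (intro hull_inc imageI)
      next
        case False
        obtain g where g: "g \<in> N" "is_lead t g (w # us) i"
          using Cons.prems by (auto simp: leads_def)
        obtain m h where mh: "g = m + h" "tails_bounded D m" "tails_in N h"
          using tails_decomposition[OF G(2) D] g(1) unfolding N by blast
        obtain n where "n \<in> N" "is_lead t n us i"
          using is_lead_tail[of t m h w us i D N] g(2) mh ne False by auto
        then have "mon_vector (us, i) \<in> ?H" using Cons.IH by (auto simp: leads_def)
        from left_submodule_mult[OF H this, of "x_power w * alg_f"]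
        have "(\<lambda>j. x_power w * alg_f * mon_vector (us, i) j) \<in> ?H" .
        moreover have "(\<lambda>j. x_power w * alg_f * mon_vector (us, i) j) =
            (mon_vector (w # us, i) :: nat \<Rightarrow> ('p, 'n) alg)"
          using ne by (simp add: mon_vector_def fun_eq_iff monomial_product_Cons mult.assoc)
        ultimately show ?thesis by simp
      qed
    qed
  qed
  then have "mon_vector ` leads t N \<subseteq> ?H" by auto
  then have "left_submodule t hull (mon_vector ` leads t N) \<subseteq> ?H"
    using H by (rule hull_minimal)
  moreover have "?H \<subseteq> left_submodule t hull (mon_vector ` leads t N)"
    by (intro hull_mono image_mono sub)
  ultimately have "left_submodule t hull (mon_vector ` leads t N) = ?H" by blast
  then have "initial_submodule t N = ?H"
    using initial_submodule_eq left_submodule_free[OF assms(1)] by metis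
  then show ?thesis
    unfolding finitely_generated_def using \<open>finite L\<close> free by blast
qed

theorem theorem4p10:
  fixes t :: nat and \<delta> :: "nat \<Rightarrow> int"
    and N :: "(nat \<Rightarrow> ('p::prime_card, 'n::{finite,linorder}) alg) set"
  assumes "graded_submodule t \<delta> N"
    and "finitely_generated t N"
  shows "finitely_generated t (initial_submodule t N)"
  using assms by (intro initial_submodule_finitely_generated) (simp_all add: graded_submodule_def)

end
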